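(* Let $n\ge 1$ and let $F$ be a constant real 2-form on $\mathbb{R}^{n,1}$. Then, under the action of the Lorentz group $O_{n,1}$, $F$ can be brought into one of the following forms: (a) $F=0$; (b) $F=\sum_{i=1}^r b_i\,dx^{2i-1}\wedge dx^{2i}$, with $b_1\ge b_2\ge\dots\ge b_r>0$ (where $r\ge 1$, $2r\le n$); (c) $F=a\,dx^0\wedge dx^1$, with $a>0$; (d) $F=a\,dx^0\wedge dx^1+\sum_{i=1}^r b_i\,dx^{2i}\wedge dx^{2i+1}$, with $a>0$ and $b_1\ge b_2\ge\dots\ge b_r>0$ (where $r\ge1$, $2r+1\le n$); (e) $F=dx^0\wedge dx^1+dx^1\wedge dx^2$ (where $n\ge 2$); (f) $F=dx^0\wedge dx^1+dx^1\wedge dx^2+\sum_{i=1}^r b_i\,dx^{2i+1}\wedge dx^{2i+2}$, with $b_1\ge b_2\ge\dots\ge b_r>0$ (where $r\ge 1$, $2r+2\le n$). Moreover, this gives a canonical classification of constant 2-forms: two different members of this list (different types, or the same type with different parameters) are not related by the action of $O_{n,1}$.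
   Context: $\mathbb{R}^{n,1}$ is the $(n+1)$-dimensional Minkowski spacetime with inertial coordinates $(x^0,x^1,\dots,x^n)$ and metric $\eta=-(dx^0)^2+\sum_{i=1}^n(dx^i)^2$. A constant 2-form is $F=\sum_{\mu<\nu}F_{\mu\nu}\,dx^\mu\wedge dx^\nu$ with real constants $F_{\mu\nu}=-F_{\nu\mu}$. $O_{n,1}$ is the full group of linear isometries of $\eta$; it acts on $F$ by $F_{\mu\nu}\mapsto\Lambda_\mu{}^\lambda\Lambda_\nu{}^\rho F_{\lambda\rho}$, i.e. by passing to the inertial coordinates $x'^\mu=\Lambda^\mu{}_\nu x^\nu$. *)

theory Defs
  imports "Jordan_Normal_Form.Matrix"
begin

text \<open>Vectors, covariant 2-tensors and linear maps of $(n+1)$-dimensional Minkowski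
  spacetime are given by their components in the inertial coordinates $x^0, \dots, x^n$,
  so all matrices below are $(n+1) \times (n+1)$ and indexed from $0$.\<close>

definition minkowski_metric :: "nat \<Rightarrow> real mat" where
  "minkowski_metric n = mat (n + 1) (n + 1)
     (\<lambda>(\<mu>, \<nu>). if \<mu> = \<nu> then (if \<mu> = 0 then - 1 else 1) else 0)"

definition minkowski_product :: "nat \<Rightarrow> real vec \<Rightarrow> real vec \<Rightarrow> real" where
  "minkowski_product n x y = x \<bullet> (minkowski_metric n *\<^sub>v y)"

text \<open>The full group of linear isometries; invertibility is automatic because the
  metric is nondegenerate. The $(\mu,\nu)$ entry of a matrix is $\Lambda^\mu{}_\nu$.\<close>

definition lorentz_group :: "nat \<Rightarrow> real mat set" where
  "lorentz_group n = {\<Lambda> \<in> carrier_mat (n + 1) (n + 1).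
     \<forall>x \<in> carrier_vec (n + 1). \<forall>y \<in> carrier_vec (n + 1).
       minkowski_product n (\<Lambda> *\<^sub>v x) (\<Lambda> *\<^sub>v y) = minkowski_product n x y}"

text \<open>A constant 2-form $\sum_{\mu<\nu} F_{\mu\nu}\, dx^\mu \wedge dx^\nu$ is the
  antisymmetric matrix of its components.\<close>

definition two_forms :: "nat \<Rightarrow> real mat set" where
  "two_forms n = {F \<in> carrier_mat (n + 1) (n + 1). transpose_mat F = - F}"

text \<open>The matrix $\Lambda_\mu{}^\sigma = \eta_{\mu\alpha} \Lambda^\alpha{}_\beta \eta^{\beta\sigma}$;
  the inverse metric $\eta^{\beta\sigma}$ has the same matrix as $\eta_{\mu\alpha}$.\<close>

definition lower_raise :: "nat \<Rightarrow> real mat \<Rightarrow> real mat" where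
  "lower_raise n \<Lambda> = minkowski_metric n * \<Lambda> * minkowski_metric n"

text \<open>$F_{\mu\nu} \mapsto \Lambda_\mu{}^\sigma \Lambda_\nu{}^\rho F_{\sigma\rho}$.\<close>

definition lorentz_act :: "nat \<Rightarrow> real mat \<Rightarrow> real mat \<Rightarrow> real mat" where
  "lorentz_act n \<Lambda> F = mat (n + 1) (n + 1) (\<lambda>(\<mu>, \<nu>).
     \<Sum>\<sigma>\<le>n. \<Sum>\<rho>\<le>n. lower_raise n \<Lambda> $$ (\<mu>, \<sigma>) * lower_raise n \<Lambda> $$ (\<nu>, \<rho>) * F $$ (\<sigma>, \<rho>))"

text \<open>The $(\alpha,\beta)$ component of $dx^\mu \wedge dx^\nu$.\<close>

definition dx_wedge :: "nat \<Rightarrow> nat \<Rightarrow> nat \<Rightarrow> nat \<Rightarrow> real" where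
  "dx_wedge \<mu> \<nu> \<alpha> \<beta> = of_bool (\<alpha> = \<mu> \<and> \<beta> = \<nu>) - of_bool (\<alpha> = \<nu> \<and> \<beta> = \<mu>)"

lemma two_forms_expansion:
  assumes "F \<in> two_forms n"
  shows "F = mat (n + 1) (n + 1) (\<lambda>(\<alpha>, \<beta>).
    \<Sum>(\<mu>, \<nu>) \<in> {(\<mu>, \<nu>). \<mu> < \<nu> \<and> \<nu> \<le> n}. F $$ (\<mu>, \<nu>) * dx_wedge \<mu> \<nu> \<alpha> \<beta>)"
proof (rule eq_matI; clarsimp)
  fix \<alpha> \<beta> assume ab: "\<alpha> < Suc n" "\<beta> < Suc n"
  let ?S = "{(\<mu>, \<nu>). \<mu> < \<nu> \<and> \<nu> \<le> n}"
  have fin: "finite ?S"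
    by (rule finite_subset[of _ "{..n} \<times> {..n}"]) auto
  have F: "F \<in> carrier_mat (n + 1) (n + 1)" "transpose_mat F = - F"
    using assms by (auto simp: two_forms_def)
  have skew: "F $$ (\<beta>, \<alpha>) = - F $$ (\<alpha>, \<beta>)"
    using arg_cong[OF F(2), of "\<lambda>M. M $$ (\<alpha>, \<beta>)"] F(1) ab by simp
  have "(\<Sum>(\<mu>, \<nu>) \<in> ?S. F $$ (\<mu>, \<nu>) * dx_wedge \<mu> \<nu> \<alpha> \<beta>) =
      (\<Sum>p \<in> ?S. if p = (\<alpha>, \<beta>) then F $$ p else 0) - (\<Sum>p \<in> ?S. if p = (\<beta>, \<alpha>) then F $$ p else 0)"
    unfolding sum_subtractf[symmetric]
    by (rule sum.cong) (simp_all add: dx_wedge_def of_bool_def split_beta prod_eq_iff)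
  also have "\<dots> = F $$ (\<alpha>, \<beta>)"
  proof (cases \<alpha> \<beta> rule: linorder_cases)
    case equal
    have "F $$ (\<alpha>, \<beta>) = 0"
      using skew unfolding equal by linarith
    then show ?thesis
      using equal fin by simp
  next
    case greater
    have "F $$ (\<alpha>, \<beta>) = - F $$ (\<beta>, \<alpha>)"
      using skew by linarith
    then show ?thesis
      using greater fin ab by simp
  qed (use fin ab in simp)
  finally show "F $$ (\<alpha>, \<beta>) = (\<Sum>(\<mu>, \<nu>) \<in> ?S. F $$ (\<mu>, \<nu>) * dx_wedge \<mu> \<nu> \<alpha> \<beta>)"
    by simp
qed (use assms in \<open>auto simp: two_forms_def\<close>)

text \<open>The lists hold the coefficients $b_1, \dots, b_r$.\<close>

datatype normal_form =
    Zero
  | Rotations "real list"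
  | Boost real
  | Boost_Rotations real "real list"
  | Null
  | Null_Rotations "real list"

definition admissible_coeffs :: "real list \<Rightarrow> bool" where
  "admissible_coeffs bs \<longleftrightarrow> bs \<noteq> [] \<and> sorted_wrt (\<ge>) bs \<and> (\<forall>b \<in> set bs. b > 0)"

fun admissible :: "nat \<Rightarrow> normal_form \<Rightarrow> bool" where
  "admissible n Zero \<longleftrightarrow> True"
| "admissible n (Rotations bs) \<longleftrightarrow> admissible_coeffs bs \<and> 2 * length bs \<le> n"
| "admissible n (Boost a) \<longleftrightarrow> a > 0"
| "admissible n (Boost_Rotations a bs) \<longleftrightarrow>
     a > 0 \<and> admissible_coeffs bs \<and> 2 * length bs + 1 \<le> n"
| "admissible n Null \<longleftrightarrow> n \<ge> 2"
| "admissible n (Null_Rotations bs) \<longleftrightarrow> admissible_coeffs bs \<and> 2 * length bs + 2 \<le> n"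

text \<open>$\sum_{i=1}^r b_i\, dx^{k+2i-2} \wedge dx^{k+2i-1}$: consecutive coordinate planes
  starting with the $(x^k, x^{k+1})$-plane.\<close>

definition rotation_part :: "nat \<Rightarrow> real list \<Rightarrow> nat \<Rightarrow> nat \<Rightarrow> real" where
  "rotation_part k bs \<alpha> \<beta> =
     (\<Sum>i < length bs. bs ! i * dx_wedge (k + 2 * i) (k + 2 * i + 1) \<alpha> \<beta>)"

fun normal_form_components :: "normal_form \<Rightarrow> nat \<Rightarrow> nat \<Rightarrow> real" where
  "normal_form_components Zero \<alpha> \<beta> = 0"
| "normal_form_components (Rotations bs) \<alpha> \<beta> = rotation_part 1 bs \<alpha> \<beta>"
| "normal_form_components (Boost a) \<alpha> \<beta> = a * dx_wedge 0 1 \<alpha> \<beta>"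
| "normal_form_components (Boost_Rotations a bs) \<alpha> \<beta> =
     a * dx_wedge 0 1 \<alpha> \<beta> + rotation_part 2 bs \<alpha> \<beta>"
| "normal_form_components Null \<alpha> \<beta> = dx_wedge 0 1 \<alpha> \<beta> + dx_wedge 1 2 \<alpha> \<beta>"
| "normal_form_components (Null_Rotations bs) \<alpha> \<beta> =
     dx_wedge 0 1 \<alpha> \<beta> + dx_wedge 1 2 \<alpha> \<beta> + rotation_part 3 bs \<alpha> \<beta>"

definition normal_two_form :: "nat \<Rightarrow> normal_form \<Rightarrow> real mat" where
  "normal_two_form n t = mat (n + 1) (n + 1) (\<lambda>(\<alpha>, \<beta>). normal_form_components t \<alpha> \<beta>)"

lemma normal_two_form_in_two_forms: "normal_two_form n t \<in> two_forms n"
proof -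
  have w: "dx_wedge \<mu> \<nu> \<beta> \<alpha> = - dx_wedge \<mu> \<nu> \<alpha> \<beta>" for \<mu> \<nu> \<alpha> \<beta>
    unfolding dx_wedge_def by (simp only: minus_diff_eq conj_commute)
  have r: "rotation_part k bs \<beta> \<alpha> = - rotation_part k bs \<alpha> \<beta>" for k bs \<alpha> \<beta>
    unfolding rotation_part_def w[of _ _ \<beta> \<alpha>] by (simp add: sum_negf)
  have c: "normal_form_components t \<beta> \<alpha> = - normal_form_components t \<alpha> \<beta>" for \<alpha> \<beta>
    by (cases t) (simp_all add: w[of _ _ \<beta> \<alpha>] r[of _ _ \<beta> \<alpha>])
  show ?thesis
    unfolding two_forms_def normal_two_form_def
    by (auto intro!: eq_matI c)
qed

end

theory Submission
  imports Defs "Jordan_Normal_Form.Spectral_Radius"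
begin

text \<open>In matrix form the action is $F \mapsto L F L^T$ with $L \eta L^T = \eta$, so a normal form
  amounts to a pseudo-orthonormal frame adapted to $F$. If the span of the first $k$ frame vectors,
  one of them timelike, is invariant under $\eta F$, then $F$ splits into a $k \times k$ block and a
  Euclidean skew form, which decomposes into rotation planes by the spectral theorem for its square.

  To find such vectors, first bring the magnetic part $B$ into normal form, so that
  $B^2 = -\mathrm{diag}(d)$ is diagonal. With $E$ the electric field, put
  $g(s) = \sum_i E_i^2 / (s + d_i)$. If $g(\lambda^2) = 1$ for some $\lambda > 0$ and
  $z_i = E_i / (\lambda^2 + d_i)$, then $(1, Bz)$ and $(0, \lambda z)$ span a boost plane with
  eigenvalues $\pm\lambda$. Otherwise $g < 1$ on $(0, \infty)$, so $E_i = 0$ wherever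
  $d_i = 0$, and for $z_i = E_i / d_i$ (with $0/0 = 0$) the vector $(1, Bz)$ lies in the kernel and has
  squared length $g(0) - 1 \le 0$. If it is timelike, $F$ is a sum of rotations;
  if it is null, it ends a chain $(0, -By) \mapsto (0, z) \mapsto (1, Bz) \mapsto 0$ of $\eta F$ with
  $y_i = z_i / d_i$, which spans the null block.

  Conversely, $(\eta F)^2$ is determined by the orbit up to similarity. Its characteristic polynomial
  yields all parameters, and semisimplicity of its eigenvalue 0 detects the null block.\<close>

section \<open>Skew matrices\<close>

text \<open>The metric is indefinite, so \<open>\<eta>F\<close> need not be diagonalizable, and an
  invariant subspace may be degenerate, with no complement to pass to. All the difficulty lies in
  finding one small nondegenerate invariant block that contains a timelike vector; its complement is
  Euclidean. The vectors of the overview come from the eigenvalue equation \<eta>F(1, p) =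
  \<lambda>(1, p), which reads E + Bp = \<lambda>p and E.p = \<lambda>. Hence p = (\<lambda> - B)^-1
  E = (\<lambda> + B)z with z = (\<lambda>^2 - B^2)^-1 E. Skewness gives E.Bz = 0, so the second
  condition becomes E.z = 1, that is g(\<lambda>^2) = 1. The eigenvectors for \<lambda> and
  -\<lambda> are (1, Bz + \<lambda>z) and (1, Bz - \<lambda>z); half their sum and half their
  difference are the two vectors that span the boost plane. Diagonalizing B^2 beforehand is what
  makes this a scalar equation, open to the intermediate value theorem. For uniqueness the square of
  \<eta>F is preferred to \<eta>F itself because it is diagonal on every normal form except the null
  ones.\<close>

definition skew_mats :: "nat \<Rightarrow> real mat set" where
  "skew_mats N = {F \<in> carrier_mat N N. transpose_mat F = - F}"

lemma skew_matsD:
  assumes "F \<in> skew_mats N"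
  shows "F \<in> carrier_mat N N" "transpose_mat F = - F"
  using assms by (auto simp: skew_mats_def)

lemma skew_scalar_prod:
  assumes F: "F \<in> skew_mats N" and x: "x \<in> carrier_vec N" and y: "y \<in> carrier_vec N"
  shows "x \<bullet> (F *\<^sub>v y) = - (y \<bullet> (F *\<^sub>v x))"
proof -
  note F' = skew_matsD[OF F]
  have "y \<bullet> (F *\<^sub>v x) = (transpose_mat F *\<^sub>v y) \<bullet> x"
    using transpose_vec_mult_scalar[OF F'(1) x y] by simp
  also have "\<dots> = - ((F *\<^sub>v y) \<bullet> x)"
    using F' x y by simp
  also have "\<dots> = - (x \<bullet> (F *\<^sub>v y))"
    using comm_scalar_prod[of "F *\<^sub>v y" N x] F'(1) x y by simp
  finally show ?thesis by simp
qed

lemma skew_scalar_prod_self: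
  assumes "F \<in> skew_mats N" "x \<in> carrier_vec N"
  shows "x \<bullet> (F *\<^sub>v x) = 0"
  using skew_scalar_prod[OF assms(1,2,2)] by simp

text \<open>Reads \<open>L * F * transpose_mat L\<close> as the table of values of the bilinear form
  \<open>F\<close> on the rows of \<open>L\<close>: a change of coordinates is the choice of a
  frame, and the rows are its vectors.\<close>

lemma congruence_index:
  fixes L F :: "real mat"
  assumes "L \<in> carrier_mat N N" "F \<in> carrier_mat N N" "i < N" "j < N"
  shows "(L * F * transpose_mat L) $$ (i, j) = row L i \<bullet> (F *\<^sub>v row L j)"
proof -
  have "L * F * transpose_mat L = L * (F * transpose_mat L)"
    using assms by (intro assoc_mult_mat) auto
  then show ?thesis
    using assms by (simp add: mult_mat_vec_def)
qed

lemma congruence_skew: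
  assumes L: "L \<in> carrier_mat N N" and F: "F \<in> skew_mats N"
  shows "L * F * transpose_mat L \<in> skew_mats N"
proof -
  note F' = skew_matsD[OF F]
  have "(L * F * transpose_mat L) $$ (j, i) = - (L * F * transpose_mat L) $$ (i, j)"
    if "i < N" "j < N" for i j
    unfolding congruence_index[OF L F'(1) that] congruence_index[OF L F'(1) that(2,1)]
    by (rule skew_scalar_prod[OF F]) (use L that in auto)
  note skew = this
  have "transpose_mat (L * F * transpose_mat L) = - (L * F * transpose_mat L)"
  proof (rule eq_matI)
    fix i j assume "i < dim_row (- (L * F * transpose_mat L))" "j < dim_col (- (L * F * transpose_mat L))"
    then have ij: "i < N" "j < N" using L by simp_all
    then have "transpose_mat (L * F * transpose_mat L) $$ (i, j) = (L * F * transpose_mat L) $$ (j, i)"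
      using L by (intro index_transpose_mat) simp_all
    also have "\<dots> = - ((L * F * transpose_mat L) $$ (i, j))"
      by (rule skew[OF ij])
    also have "\<dots> = (- (L * F * transpose_mat L)) $$ (i, j)"
      using L ij by (intro index_uminus_mat(1)[symmetric]) simp_all
    finally show "transpose_mat (L * F * transpose_mat L) $$ (i, j) = (- (L * F * transpose_mat L)) $$ (i, j)" .
  qed (use L in simp_all)
  then show ?thesis
    using L F' by (simp add: skew_mats_def)
qed

section \<open>Pseudo-orthonormal frames\<close>

text \<open>The sign \<open>s\<close> lets one construction serve the Euclidean metric
  (\<open>s = 1\<close>) and the Minkowski metric (\<open>s = - 1\<close>).\<close>

definition signature_mat :: "real \<Rightarrow> nat \<Rightarrow> real mat" where
  "signature_mat s N = mat N N (\<lambda>(i, j). if i = j then (if i = 0 then s else 1) else 0)"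

lemma signature_mat_carrier [simp, intro]: "signature_mat s N \<in> carrier_mat N N"
  by (simp add: signature_mat_def)

lemma signature_mat_dim [simp]: "dim_row (signature_mat s N) = N" "dim_col (signature_mat s N) = N"
  by (simp_all add: signature_mat_def)

lemma signature_mat_index [simp]:
  "i < N \<Longrightarrow> j < N \<Longrightarrow>
    signature_mat s N $$ (i, j) = (if i = j then (if i = 0 then s else 1) else 0)"
  by (simp add: signature_mat_def)

lemma signature_mat_one: "signature_mat 1 N = 1\<^sub>m N"
  by (rule eq_matI) auto

lemma transpose_signature_mat [simp]: "transpose_mat (signature_mat s N) = signature_mat s N"
  by (rule eq_matI) auto

lemma signature_mat_vec_index:
  assumes "x \<in> carrier_vec N" "i < N"
  shows "(signature_mat s N *\<^sub>v x) $ i = (if i = 0 then s * x $ 0 else x $ i)"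
proof -
  have "(signature_mat s N *\<^sub>v x) $ i = (\<Sum>j = 0..<N. signature_mat s N $$ (i, j) * x $ j)"
    using assms by (auto simp: scalar_prod_def)
  also have "\<dots> = (\<Sum>j = 0..<N. if j = i then (if i = 0 then s * x $ 0 else x $ i) else 0)"
    using assms by (intro sum.cong) auto
  also have "\<dots> = (if i = 0 then s * x $ 0 else x $ i)"
    using assms by simp
  finally show ?thesis .
qed

lemma signature_mat_square:
  assumes "s\<^sup>2 = 1"
  shows "signature_mat s N * signature_mat s N = 1\<^sub>m N"
proof (rule eq_matI)
  fix i j assume ij: "i < dim_row (1\<^sub>m N :: real mat)" "j < dim_col (1\<^sub>m N :: real mat)"
  have "(signature_mat s N * signature_mat s N) $$ (i, j) = (signature_mat s N *\<^sub>v col (signature_mat s N) j) $ i"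
    using ij by simp
  also have "\<dots> = 1\<^sub>m N $$ (i, j)"
    using ij assms by (subst signature_mat_vec_index) (auto simp: power2_eq_square)
  finally show "(signature_mat s N * signature_mat s N) $$ (i, j) = 1\<^sub>m N $$ (i, j)" .
qed simp_all

lemma signature_scalar_prod:
  assumes "x \<in> carrier_vec N" "y \<in> carrier_vec N" "N > 0"
  shows "x \<bullet> (signature_mat s N *\<^sub>v y) = s * x $ 0 * y $ 0 + (\<Sum>i = 1..<N. x $ i * y $ i)"
proof -
  have "x \<bullet> (signature_mat s N *\<^sub>v y) = (\<Sum>i = 0..<N. x $ i * (signature_mat s N *\<^sub>v y) $ i)"
    using assms by (auto simp: scalar_prod_def)
  also have "\<dots> = x $ 0 * (signature_mat s N *\<^sub>v y) $ 0 + (\<Sum>i = 1..<N. x $ i * (signature_mat s N *\<^sub>v y) $ i)"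
    using assms(3) by (simp add: sum.atLeast_Suc_lessThan)
  also have "\<dots> = s * x $ 0 * y $ 0 + (\<Sum>i = 1..<N. x $ i * y $ i)"
    using assms by (simp add: signature_mat_vec_index del: index_mult_mat_vec)
  finally show ?thesis .
qed

lemma signature_scalar_prod_commute:
  assumes "x \<in> carrier_vec N" "y \<in> carrier_vec N"
  shows "x \<bullet> (signature_mat s N *\<^sub>v y) = y \<bullet> (signature_mat s N *\<^sub>v x)"
proof (cases "N = 0")
  case True
  then show ?thesis using assms by (auto simp: scalar_prod_def)
next
  case False
  then show ?thesis using assms by (simp add: signature_scalar_prod mult.commute mult.left_commute)
qed

text \<open>For \<open>s = 1\<close> this is definiteness. For \<open>s = - 1\<close> put t = z_0 /
  x_0: the vector z - t x has no time component, so its square is nonnegative, and by orthogonality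
  that square equals <z,z> - t^2. If t = 0, then z itself is spatial and nonzero.\<close>

lemma signature_scalar_prod_pos:
  assumes s: "s = 1 \<or> s = - 1" and N: "N > 0"
    and x: "x \<in> carrier_vec N" and z: "z \<in> carrier_vec N" "z \<noteq> 0\<^sub>v N"
    and xx: "x \<bullet> (signature_mat s N *\<^sub>v x) = s"
    and xz: "x \<bullet> (signature_mat s N *\<^sub>v z) = 0"
  shows "z \<bullet> (signature_mat s N *\<^sub>v z) > 0"
proof -
  define X where "X = (\<Sum>i = 1..<N. x $ i * x $ i)"
  define Z where "Z = (\<Sum>i = 1..<N. z $ i * z $ i)"
  define C where "C = (\<Sum>i = 1..<N. x $ i * z $ i)"
  have Z0: "Z \<ge> 0" and X0: "X \<ge> 0" unfolding Z_def X_def by (auto intro!: sum_nonneg)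
  have nz: "z $ 0 \<noteq> 0 \<or> Z > 0"
  proof (rule ccontr)
    assume a: "\<not> ?thesis"
    then have "Z = 0" using Z0 by linarith
    then have "\<forall>i \<in> {1..<N}. z $ i * z $ i = 0"
      unfolding Z_def by (subst (asm) sum_nonneg_eq_0_iff) auto
    then have "z $ i = 0" if "i < N" for i
      using a that by (cases "i = 0") auto
    then have "z = 0\<^sub>v N" using z(1) by (intro eq_vecI) auto
    with z(2) show False by simp
  qed
  have zz: "z \<bullet> (signature_mat s N *\<^sub>v z) = s * (z $ 0)\<^sup>2 + Z"
    using signature_scalar_prod[OF z(1) z(1) N] by (simp add: Z_def power2_eq_square mult.assoc)
  show ?thesis
  proof (cases "s = 1")
    case True
    then show ?thesis using nz Z0 zz by (cases "z $ 0 = 0") (auto simp: add_pos_nonneg)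
  next
    case False
    with s have s: "s = - 1" by simp
    have 1: "(x $ 0)\<^sup>2 = 1 + X"
      using xx signature_scalar_prod[OF x x N, of s] s by (simp add: X_def power2_eq_square)
    have 2: "x $ 0 * z $ 0 = C"
      using xz signature_scalar_prod[OF x z(1) N, of s] s by (simp add: C_def)
    define t where "t = z $ 0 / x $ 0"
    have x0: "x $ 0 \<noteq> 0" using 1 X0 by auto
    then have t: "z $ 0 = t * x $ 0" by (simp add: t_def)
    have "0 \<le> (\<Sum>i = 1..<N. (z $ i - t * x $ i)\<^sup>2)"
      by (intro sum_nonneg) simp
    also have "\<dots> = Z - 2 * t * C + t\<^sup>2 * X"
      unfolding Z_def C_def X_def sum_distrib_left sum_subtractf[symmetric] sum.distrib[symmetric]
      by (intro sum.cong) (auto simp: power2_eq_square algebra_simps)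
    also have "C = t * (1 + X)"
      using 2 t by (simp add: 1[symmetric] power2_eq_square mult_ac)
    finally have "t\<^sup>2 + t\<^sup>2 * (1 + X) \<le> Z"
      by (simp add: power2_eq_square algebra_simps)
    then have 3: "t\<^sup>2 + (z $ 0)\<^sup>2 \<le> Z"
      unfolding 1[symmetric] t by (simp add: power_mult_distrib)
    have "Z > (z $ 0)\<^sup>2"
    proof (cases "t = 0")
      case True
      then show ?thesis using nz t by simp
    next
      case False
      then have "t\<^sup>2 > 0" by simp
      with 3 show ?thesis by linarith
    qed
    then show ?thesis using zz s by simp
  qed
qed

text \<open>The condition is on the rows of \<open>L\<close>, which form a pseudo-orthonormal frame;
  membership in \<open>lorentz_group\<close> constrains the columns instead.\<close>

definition pseudo_orthogonal :: "real \<Rightarrow> nat \<Rightarrow> real mat \<Rightarrow> bool" where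
  "pseudo_orthogonal s N L \<longleftrightarrow>
     L \<in> carrier_mat N N \<and> L * signature_mat s N * transpose_mat L = signature_mat s N"

text \<open>The \<open>k\<close> linear conditions, filled up with zero rows, form a square matrix.
  Its determinant vanishes because row \<open>k\<close> is zero, and a kernel vector is the
  solution.\<close>

lemma exists_orthogonal_vec:
  fixes G :: "real mat"
  assumes G: "G \<in> carrier_mat N N" and e: "\<And>i. i < k \<Longrightarrow> e i \<in> carrier_vec N" and k: "k < N"
  obtains z where "z \<in> carrier_vec N" "z \<noteq> 0\<^sub>v N" "\<And>i. i < k \<Longrightarrow> e i \<bullet> (G *\<^sub>v z) = 0"
proof -
  define c where "c = (\<lambda>i. if i < k then transpose_mat G *\<^sub>v e i else 0\<^sub>v N)"
  have c: "c \<in> {0..<N} \<rightarrow> carrier_vec N"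
    using G e by (auto simp: c_def)
  let ?M = "mat\<^sub>r N N (\<lambda>i. if i = k then 0\<^sub>v N else c i)"
  have M: "?M \<in> carrier_mat N N" by simp
  from det_row_0[OF k c] obtain z where z: "z \<in> carrier_vec N" "z \<noteq> 0\<^sub>v N" "?M *\<^sub>v z = 0\<^sub>v N"
    using det_0_iff_vec_prod_zero_field[OF M] by auto
  have "e i \<bullet> (G *\<^sub>v z) = 0" if i: "i < k" for i
  proof -
    have "(?M *\<^sub>v z) $ i = c i \<bullet> z"
      using i k c by (subst index_mult_mat_vec) (auto simp: Pi_iff)
    then have "c i \<bullet> z = 0" using z(3) i k by simp
    then show ?thesis
      using transpose_vec_mult_scalar[OF G z(1) e[OF i]] i by (simp add: c_def)
  qed
  with z that show ?thesis by blast
qed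

text \<open>Gram-Schmidt adds vectors until there are \<open>N\<close>, hence the downward
  induction. A vector orthogonal to the frame is orthogonal to \<open>e 0\<close>, whose square is
  \<open>s\<close>, so its own square is positive and it can be normalized; this is why the given
  frame must be nonempty.\<close>

lemma extend_frame:
  fixes e :: "nat \<Rightarrow> real vec"
  assumes s: "s = 1 \<or> s = - 1" and k: "0 < k" "k \<le> N"
    and e: "\<And>i. i < k \<Longrightarrow> e i \<in> carrier_vec N"
    and orth: "\<And>i j. i < k \<Longrightarrow> j < k \<Longrightarrow> e i \<bullet> (signature_mat s N *\<^sub>v e j) = signature_mat s N $$ (i, j)"
  shows "\<exists>L. pseudo_orthogonal s N L \<and> (\<forall>i < k. row L i = e i)"
  using k(2,1) e orth
proof (induction k arbitrary: e rule: inc_induct)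
  case base
  let ?L = "mat\<^sub>r N N e"
  have r: "row ?L i = e i" if "i < N" for i using that base by simp
  have "?L * signature_mat s N * transpose_mat ?L = signature_mat s N"
  proof (rule eq_matI)
    fix i j assume "i < dim_row (signature_mat s N)" "j < dim_col (signature_mat s N)"
    then have ij: "i < N" "j < N" by simp_all
    show "(?L * signature_mat s N * transpose_mat ?L) $$ (i, j) = signature_mat s N $$ (i, j)"
      unfolding congruence_index[OF mat_row_carrierI[of N N e] signature_mat_carrier ij] r[OF ij(1)] r[OF ij(2)]
      by (rule base.prems(3)[OF ij])
  qed simp_all
  then have "pseudo_orthogonal s N ?L" by (simp add: pseudo_orthogonal_def)
  with r show ?case by blast
next
  case (step k)
  let ?G = "signature_mat s N"
  obtain z where z: "z \<in> carrier_vec N" "z \<noteq> 0\<^sub>v N" "\<And>i. i < k \<Longrightarrow> e i \<bullet> (?G *\<^sub>v z) = 0"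
    using exists_orthogonal_vec[where e = e, OF signature_mat_carrier[of s N] step.prems(2) step.hyps(2)]
    by metis
  have N: "N > 0" using step by simp
  have "z \<bullet> (?G *\<^sub>v z) > 0"
    by (rule signature_scalar_prod_pos[OF s N _ z(1,2), of "e 0"])
      (use step.prems N z(3) in simp_all)
  define r where "r = 1 / sqrt (z \<bullet> (?G *\<^sub>v z))"
  have r: "r * r * (z \<bullet> (?G *\<^sub>v z)) = 1"
    using \<open>z \<bullet> (?G *\<^sub>v z) > 0\<close> by (simp add: r_def)
  define e' where "e' = e(k := r \<cdot>\<^sub>v z)"
  have e': "e' i \<in> carrier_vec N" if "i < Suc k" for i
    using that step.prems(2) z(1) by (auto simp: e'_def)
  have o': "e' i \<bullet> (?G *\<^sub>v e' j) = ?G $$ (i, j)" if ij: "i < Suc k" "j < Suc k" for i j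
  proof -
    have lin: "?G *\<^sub>v (r \<cdot>\<^sub>v z) = r \<cdot>\<^sub>v (?G *\<^sub>v z)"
      using z(1) by (intro mult_mat_vec) auto
    have zc: "?G *\<^sub>v z \<in> carrier_vec N" using z(1) by (intro mult_mat_vec_carrier) auto
    consider "i < k" "j < k" | "i < k" "j = k" | "i = k" "j < k" | "i = k" "j = k"
      using ij less_Suc_eq by blast
    then show ?thesis
    proof cases
      case 1
      then show ?thesis using step.prems(3) by (simp add: e'_def)
    next
      case 2
      then show ?thesis
        using step.prems(2)[of i] step.hyps(2) z zc by (auto simp: e'_def lin)
    next
      case 3
      have "z \<bullet> (?G *\<^sub>v e j) = 0"
        using signature_scalar_prod_commute[OF z(1) step.prems(2)[OF 3(2)], of s] z(3)[OF 3(2)] by simp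
      moreover have "?G *\<^sub>v e j \<in> carrier_vec N"
        using step.prems(2)[OF 3(2)] by (intro mult_mat_vec_carrier) auto
      ultimately show ?thesis
        using 3 step.hyps(2) z by (auto simp: e'_def)
    next
      case 4
      then show ?thesis
        using step.hyps(2) step.prems(1) z zc r by (auto simp: e'_def lin)
    qed
  qed
  obtain L where L: "pseudo_orthogonal s N L" "\<forall>i < Suc k. row L i = e' i"
    using step.IH[OF _ e' o'] by auto
  then have "\<forall>i < k. row L i = e i" by (auto simp: e'_def)
  with L(1) show ?case by blast
qed

section \<open>Block-diagonal matrices and splitting off a frame\<close>

definition block_diag :: "real mat \<Rightarrow> real mat \<Rightarrow> real mat" where
  "block_diag A D =
     four_block_mat A (0\<^sub>m (dim_row A) (dim_col D)) (0\<^sub>m (dim_row D) (dim_col A)) D"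

lemma block_diag_carrier [simp, intro]:
  "A \<in> carrier_mat k k \<Longrightarrow> D \<in> carrier_mat m m \<Longrightarrow> block_diag A D \<in> carrier_mat (k + m) (k + m)"
  by (auto simp: block_diag_def)

lemma block_diag_index:
  assumes "A \<in> carrier_mat k k" "D \<in> carrier_mat m m" "i < k + m" "j < k + m"
  shows "block_diag A D $$ (i, j) =
    (if i < k then if j < k then A $$ (i, j) else 0 else if j < k then 0 else D $$ (i - k, j - k))"
  using assms by (auto simp: block_diag_def)

lemma block_diag_mult:
  assumes "A \<in> carrier_mat k k" "D \<in> carrier_mat m m" "A' \<in> carrier_mat k k" "D' \<in> carrier_mat m m"
  shows "block_diag A D * block_diag A' D' = block_diag (A * A') (D * D')"
  using assms unfolding block_diag_def
  by (subst mult_four_block_mat[of _ k k _ m _ m _ _ k _ m]) auto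

lemma block_diag_transpose:
  assumes "A \<in> carrier_mat k k" "D \<in> carrier_mat m m"
  shows "transpose_mat (block_diag A D) = block_diag (transpose_mat A) (transpose_mat D)"
  using assms unfolding block_diag_def
  by (subst transpose_four_block_mat[of _ k k _ m _ m]) auto

lemma signature_mat_block_diag:
  assumes "k > 0"
  shows "signature_mat s (k + m) = block_diag (signature_mat s k) (1\<^sub>m m)"
  by (rule eq_matI) (use assms in \<open>auto simp: block_diag_index[of _ k _ m] block_diag_def\<close>)

lemma congruence_mult:
  fixes L L' F :: "real mat"
  assumes "L \<in> carrier_mat N N" "L' \<in> carrier_mat N N" "F \<in> carrier_mat N N"
  shows "(L' * L) * F * transpose_mat (L' * L) = L' * (L * F * transpose_mat L) * transpose_mat L'"
  using assms by (simp add: transpose_mult[of _ N N _ N] assoc_mult_mat[of _ N N _ N _ N] mult_carrier_mat[of _ N N _ N])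

lemma congruence_block_diag:
  assumes "Q \<in> carrier_mat m m" "K \<in> carrier_mat k k" "B \<in> carrier_mat m m"
  shows "block_diag (1\<^sub>m k) Q * block_diag K B * transpose_mat (block_diag (1\<^sub>m k) Q)
    = block_diag K (Q * B * transpose_mat Q)"
  using assms
  by (simp add: block_diag_transpose[of _ k _ m] block_diag_mult[of _ k _ m] mult_carrier_mat[of _ m m _ m])

lemma pseudo_orthogonalD:
  assumes "pseudo_orthogonal s N L"
  shows "L \<in> carrier_mat N N" "L * signature_mat s N * transpose_mat L = signature_mat s N"
  using assms by (auto simp: pseudo_orthogonal_def)

lemma pseudo_orthogonal_mult:
  assumes "pseudo_orthogonal s N L'" "pseudo_orthogonal s N L"
  shows "pseudo_orthogonal s N (L' * L)"
  using assms congruence_mult[of L N L' "signature_mat s N"]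
  by (simp add: pseudo_orthogonal_def mult_carrier_mat[of _ N N _ N])

lemma pseudo_orthogonal_block_diag:
  assumes "k > 0" "pseudo_orthogonal 1 m Q"
  shows "pseudo_orthogonal s (k + m) (block_diag (1\<^sub>m k) Q)"
  using assms congruence_block_diag[of Q m "signature_mat s k" k "1\<^sub>m m"]
  by (auto simp: pseudo_orthogonal_def signature_mat_one signature_mat_block_diag)

text \<open>The hypothesis \<open>inv\<close> says dually that \<open>F *\<^sub>v e i\<close> lies
  in the span of the vectors \<open>signature_mat s (k + m) *\<^sub>v e j\<close>, so that the span
  of the frame is invariant under the metric times \<open>F\<close>. Applied to the later rows of
  the extended frame it kills one off-diagonal block, and skewness kills the other.\<close>

lemma split_off_frame:
  assumes s: "s = 1 \<or> s = - 1" and k: "0 < k" and F: "F \<in> skew_mats (k + m)"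
    and e: "\<And>i. i < k \<Longrightarrow> e i \<in> carrier_vec (k + m)"
    and orth: "\<And>i j. i < k \<Longrightarrow> j < k \<Longrightarrow>
      e i \<bullet> (signature_mat s (k + m) *\<^sub>v e j) = signature_mat s (k + m) $$ (i, j)"
    and inv: "\<And>z i. i < k \<Longrightarrow> z \<in> carrier_vec (k + m) \<Longrightarrow>
      (\<And>j. j < k \<Longrightarrow> z \<bullet> (signature_mat s (k + m) *\<^sub>v e j) = 0) \<Longrightarrow> z \<bullet> (F *\<^sub>v e i) = 0"
  obtains L B where "pseudo_orthogonal s (k + m) L" "B \<in> skew_mats m"
    "L * F * transpose_mat L = block_diag (mat k k (\<lambda>(i, j). e i \<bullet> (F *\<^sub>v e j))) B"
proof -
  let ?N = "k + m"
  obtain L where L: "pseudo_orthogonal s ?N L" and rows: "\<And>i. i < k \<Longrightarrow> row L i = e i"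
    using extend_frame[of s k ?N e, OF s k _ e orth] by auto
  note L' = pseudo_orthogonalD[OF L]
  define M where "M = L * F * transpose_mat L"
  have M: "M \<in> skew_mats ?N" unfolding M_def by (rule congruence_skew[OF L'(1) F])
  have Mc: "M \<in> carrier_mat ?N ?N" using skew_matsD[OF M] by simp
  have skew: "M $$ (i, j) = - M $$ (j, i)" if "i < ?N" "j < ?N" for i j
    using arg_cong[OF skew_matsD(2)[OF M], of "\<lambda>A. A $$ (j, i)"] Mc that by simp
  have Mi: "M $$ (i, j) = row L i \<bullet> (F *\<^sub>v row L j)" if "i < ?N" "j < ?N" for i j
    unfolding M_def by (rule congruence_index[OF L'(1) skew_matsD(1)[OF F] that])
  have low: "M $$ (i, j) = 0" if "k \<le> i" "i < ?N" "j < k" for i j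
  proof -
    have "row L i \<bullet> (signature_mat s ?N *\<^sub>v e j') = 0" if "j' < k" for j'
    proof -
      have "row L i \<bullet> (signature_mat s ?N *\<^sub>v row L j') = signature_mat s ?N $$ (i, j')"
        using congruence_index[OF L'(1) signature_mat_carrier, of i j' s] L'(2) that \<open>i < ?N\<close> by simp
      then show ?thesis using rows[OF \<open>j' < k\<close>] that \<open>k \<le> i\<close> \<open>i < ?N\<close> by simp
    qed
    then have "row L i \<bullet> (F *\<^sub>v e j) = 0"
      using L'(1) that by (intro inv) auto
    then show ?thesis using Mi[of i j] that rows[of j] by simp
  qed
  define B where "B = mat m m (\<lambda>(i, j). M $$ (i + k, j + k))"
  have "transpose_mat B = - B"
    by (rule eq_matI) (auto simp: B_def intro!: skew)
  then have B: "B \<in> skew_mats m" by (simp add: skew_mats_def B_def)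
  have "M = block_diag (mat k k (\<lambda>(i, j). e i \<bullet> (F *\<^sub>v e j))) B"
    (is "_ = block_diag ?K B")
  proof (rule eq_matI)
    fix i j assume "i < dim_row (block_diag ?K B)" "j < dim_col (block_diag ?K B)"
    then have ij: "i < ?N" "j < ?N" by (simp_all add: block_diag_def B_def)
    show "M $$ (i, j) = block_diag ?K B $$ (i, j)"
      using ij Mi[OF ij] low[of i j] low[of j i] skew[OF ij]
      by (subst block_diag_index[of _ k _ m]) (auto simp: B_def rows)
  qed (use Mc in \<open>simp_all add: block_diag_def B_def\<close>)
  with that[OF L B] show ?thesis unfolding M_def by blast
qed

section \<open>The Euclidean normal form\<close>

text \<open>The planes start at index 0, unlike in the normal forms, so that the matrix can be built
  recursively; \<open>block_diag_rotation_mat\<close> accounts for the offset.\<close>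

definition rotation_mat :: "nat \<Rightarrow> real list \<Rightarrow> real mat" where
  "rotation_mat N bs = mat N N (\<lambda>(i, j). rotation_part 0 bs i j)"

definition plane_block :: "real \<Rightarrow> real mat" where
  "plane_block b = mat 2 2 (\<lambda>(i, j). b * dx_wedge 0 1 i j)"

lemma rotation_mat_carrier [simp, intro]: "rotation_mat N bs \<in> carrier_mat N N"
  by (simp add: rotation_mat_def)

lemma plane_block_carrier [simp, intro]: "plane_block b \<in> carrier_mat 2 2"
  by (simp add: plane_block_def)

lemma rotation_part_Nil [simp]: "rotation_part k [] i j = 0"
  by (simp add: rotation_part_def)

lemma rotation_part_Cons:
  "rotation_part k (b # bs) i j = b * dx_wedge k (k + 1) i j + rotation_part (k + 2) bs i j"
  unfolding rotation_part_def by (simp add: sum.lessThan_Suc_shift del: sum.lessThan_Suc)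

lemma rotation_part_outside:
  assumes "i < k \<or> j < k"
  shows "rotation_part k bs i j = 0"
  unfolding rotation_part_def using assms by (intro sum.neutral) (auto simp: dx_wedge_def)

lemma rotation_part_shift:
  assumes "k \<le> i" "k \<le> j"
  shows "rotation_part k bs i j = rotation_part 0 bs (i - k) (j - k)"
  unfolding rotation_part_def using assms
  by (intro sum.cong refl arg_cong2[of _ _ _ _ "(*)"]) (auto simp: dx_wedge_def of_bool_def)

text \<open>Bridges two descriptions: components given by sums over shifted coordinate planes, and
  block-diagonal matrices. It yields both the recursion of \<open>rotation_mat\<close> and the block
  form of every \<open>normal_two_form\<close>.\<close>

lemma block_diag_rotation_mat:
  assumes K: "K \<in> carrier_mat k k"
    and c: "\<And>i j. i < k + m \<Longrightarrow> j < k + m \<Longrightarrow>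
      c i j = (if i < k \<and> j < k then K $$ (i, j) else 0) + rotation_part k bs i j"
  shows "mat (k + m) (k + m) (\<lambda>(i, j). c i j) = block_diag K (rotation_mat m bs)" (is "?M = ?R")
proof (rule eq_matI)
  fix i j assume "i < dim_row ?R" "j < dim_col ?R"
  then have ij: "i < k + m" "j < k + m" using K by (simp_all add: block_diag_def rotation_mat_def)
  then show "?M $$ (i, j) = ?R $$ (i, j)"
    using K c[OF ij] rotation_part_outside[of i k j bs] rotation_part_shift[of k i j bs]
    by (subst block_diag_index[of _ k _ m]) (auto simp: rotation_mat_def)
qed (use K in \<open>simp_all add: block_diag_def rotation_mat_def\<close>)

lemma rotation_mat_Cons:
  "rotation_mat (2 + m) (b # bs) = block_diag (plane_block b) (rotation_mat m bs)"
  unfolding rotation_mat_def[of "2 + m"]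
  by (rule block_diag_rotation_mat) (auto simp: rotation_part_Cons plane_block_def dx_wedge_def numeral_2_eq_2)

lemma rotation_mat_Nil: "rotation_mat N [] = 0\<^sub>m N N"
  by (rule eq_matI) (auto simp: rotation_mat_def)

section \<open>Spectral theory of symmetric matrices and of squares of skew ones\<close>

lemma scalar_prod_self_pos:
  fixes x :: "real vec"
  assumes "x \<in> carrier_vec N" "x \<noteq> 0\<^sub>v N"
  shows "x \<bullet> x > 0"
proof -
  obtain i where i: "i < N" "x $ i \<noteq> 0"
    using assms by (metis carrier_vecD eq_vecI index_zero_vec(1,2))
  have "0 < x $ i * x $ i" using i by (metis mult_neg_neg mult_pos_pos linorder_neqE)
  also have "\<dots> \<le> (\<Sum>j = 0..<N. x $ j * x $ j)"
    using i by (intro member_le_sum[of i _ "\<lambda>j. x $ j * x $ j"]) auto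
  finally show ?thesis using assms by (simp add: scalar_prod_def)
qed

text \<open>A complex eigenvector x + iy exists. Symmetry makes y.Sx and x.Sy equal, and comparing
  them gives Im \<mu> (x.x + y.y) = 0; so \<mu> is real, and x or y is a real eigenvector.\<close>

lemma symmetric_has_eigenvalue:
  fixes S :: "real mat"
  assumes S: "S \<in> carrier_mat N N" "transpose_mat S = S" and N: "N > 0"
  shows "\<exists>\<mu>. eigenvalue S \<mu>"
proof -
  let ?C = "map_mat complex_of_real S"
  have C: "?C \<in> carrier_mat N N" using S by simp
  obtain \<mu> v where v: "v \<in> carrier_vec N" "v \<noteq> 0\<^sub>v N" and ev: "?C *\<^sub>v v = \<mu> \<cdot>\<^sub>v v"
    using spectrum_non_empty[OF C N] C by (auto simp: spectrum_def eigenvalue_def eigenvector_def)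
  define x where "x = map_vec Re v"
  define y where "y = map_vec Im v"
  have xy: "x \<in> carrier_vec N" "y \<in> carrier_vec N" using v by (auto simp: x_def y_def)
  have e: "(\<Sum>j = 0..<N. of_real (S $$ (i, j)) * v $ j) = \<mu> * v $ i" if "i < N" for i
    using arg_cong[OF ev, of "\<lambda>w. w $ i"] that S v by (simp add: scalar_prod_def)
  have Sx: "S *\<^sub>v x = Re \<mu> \<cdot>\<^sub>v x - Im \<mu> \<cdot>\<^sub>v y"
  proof (rule eq_vecI)
    fix i assume "i < dim_vec (Re \<mu> \<cdot>\<^sub>v x - Im \<mu> \<cdot>\<^sub>v y)"
    then have i: "i < N" using xy by simp
    show "(S *\<^sub>v x) $ i = (Re \<mu> \<cdot>\<^sub>v x - Im \<mu> \<cdot>\<^sub>v y) $ i"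
      using arg_cong[OF e[OF i], of Re] i S v by (simp add: scalar_prod_def x_def y_def)
  qed (use S xy in simp)
  have Sy: "S *\<^sub>v y = Im \<mu> \<cdot>\<^sub>v x + Re \<mu> \<cdot>\<^sub>v y"
  proof (rule eq_vecI)
    fix i assume "i < dim_vec (Im \<mu> \<cdot>\<^sub>v x + Re \<mu> \<cdot>\<^sub>v y)"
    then have i: "i < N" using xy by simp
    show "(S *\<^sub>v y) $ i = (Im \<mu> \<cdot>\<^sub>v x + Re \<mu> \<cdot>\<^sub>v y) $ i"
      using arg_cong[OF e[OF i], of Im] i S v by (simp add: scalar_prod_def x_def y_def)
  qed (use S xy in simp)
  have nz: "x \<noteq> 0\<^sub>v N \<or> y \<noteq> 0\<^sub>v N"
  proof (rule ccontr)
    assume a: "\<not> ?thesis"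
    have "v = 0\<^sub>v N"
    proof (rule eq_vecI)
      fix i assume i: "i < dim_vec (0\<^sub>v N :: complex vec)"
      have "x $ i = 0" "y $ i = 0" using a i by simp_all
      then show "v $ i = 0\<^sub>v N $ i" using i v by (simp add: x_def y_def complex_eq_iff)
    qed (use v in simp)
    with v show False by simp
  qed
  then have pos: "x \<bullet> x + y \<bullet> y > 0"
    using scalar_prod_self_pos[OF xy(1)] scalar_prod_self_pos[OF xy(2)] xy
    by (cases "x = 0\<^sub>v N"; cases "y = 0\<^sub>v N") (auto simp: add_pos_pos)
  have "y \<bullet> (S *\<^sub>v x) = x \<bullet> (S *\<^sub>v y)"
    using transpose_vec_mult_scalar[OF S(1) xy] S xy comm_scalar_prod[of "S *\<^sub>v y" N x] by simp
  then have "Im \<mu> * (x \<bullet> x + y \<bullet> y) = 0"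
    unfolding Sx Sy using xy comm_scalar_prod[OF xy]
    by (simp add: scalar_prod_add_distrib[of _ N] scalar_prod_minus_distrib[of _ N] algebra_simps)
  with pos have "Im \<mu> = 0" by simp
  then have "S *\<^sub>v x = Re \<mu> \<cdot>\<^sub>v x" "S *\<^sub>v y = Re \<mu> \<cdot>\<^sub>v y"
    using Sx Sy xy by (auto intro!: eq_vecI)
  then show ?thesis
    using nz xy S unfolding eigenvalue_def eigenvector_def by (metis carrier_matD(1))
qed

lemma char_poly_block_diag:
  assumes "A \<in> carrier_mat k k" "D \<in> carrier_mat m m"
  shows "char_poly (block_diag A D) = char_poly A * char_poly D"
proof -
  let ?cm = "\<lambda>A. [:0, 1:] \<cdot>\<^sub>m 1\<^sub>m (dim_row A) + map_mat (\<lambda>a :: real. [:- a:]) A"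
  have "char_poly (block_diag A D) = det (?cm (block_diag A D))"
    unfolding char_poly_defs using assms by simp
  also have "?cm (block_diag A D) = four_block_mat (?cm A) (0\<^sub>m k m) (0\<^sub>m m k) (?cm D)"
    by (rule eq_matI) (use assms in \<open>auto simp: block_diag_def one_poly_def\<close>)
  also have "det \<dots> = det (?cm A) * det (?cm D)"
    by (rule det_four_block_mat_lower_left_zero[of _ k _ m]) (use assms in auto)
  finally show ?thesis unfolding char_poly_defs .
qed

lemma square_congruence:
  assumes Q: "pseudo_orthogonal 1 N Q" and F: "F \<in> carrier_mat N N"
  shows "similar_mat ((Q * F * transpose_mat Q) * (Q * F * transpose_mat Q)) (F * F)"
proof -
  have Qc: "Q \<in> carrier_mat N N" and 1: "Q * transpose_mat Q = 1\<^sub>m N"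
    using pseudo_orthogonalD[OF Q] by (simp_all add: signature_mat_one)
  have Qt: "transpose_mat Q \<in> carrier_mat N N" using Qc by simp
  have 2: "transpose_mat Q * Q = 1\<^sub>m N"
    by (rule mat_mult_left_right_inverse[OF Qc Qt 1])
  have QF: "Q * F \<in> carrier_mat N N" and FQ: "F * transpose_mat Q \<in> carrier_mat N N"
    using Qc Qt F by simp_all
  have "transpose_mat Q * (Q * F * transpose_mat Q) = F * transpose_mat Q"
    unfolding assoc_mult_mat[OF Qc F Qt] assoc_mult_mat[OF Qt Qc FQ, symmetric] 2
    by (rule left_mult_one_mat[OF FQ])
  then have "(Q * F * transpose_mat Q) * (Q * F * transpose_mat Q) = (Q * F) * (F * transpose_mat Q)"
    using assoc_mult_mat[OF QF Qt mult_carrier_mat[OF QF Qt]] by simp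
  also have "\<dots> = Q * (F * F) * transpose_mat Q"
    unfolding assoc_mult_mat[OF Qc F FQ] assoc_mult_mat[OF F F Qt, symmetric]
    by (rule assoc_mult_mat[symmetric]) (use Qc F Qt in auto)
  finally have eq: "(Q * F * transpose_mat Q) * (Q * F * transpose_mat Q) = Q * (F * F) * transpose_mat Q" .
  have "similar_mat_wit ((Q * F * transpose_mat Q) * (Q * F * transpose_mat Q)) (F * F) Q (transpose_mat Q)"
    unfolding eq by (rule similar_mat_witI[OF 1 2 refl _ _ Qc Qt]) (use Qc F Qt in auto)
  then show ?thesis unfolding similar_mat_def by blast
qed

text \<open>Serves the ordering of the coefficients: those found in a remaining block
  \<open>B\<close> still come from eigenvalues of the original \<open>F * F\<close>, hence cannot
  exceed the one split off before.\<close>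

lemma eigenvalue_square_block_diag:
  assumes Q: "pseudo_orthogonal 1 (k + m) Q" and F: "F \<in> carrier_mat (k + m) (k + m)"
    and K: "K \<in> carrier_mat k k" and B: "B \<in> carrier_mat m m"
    and eq: "Q * F * transpose_mat Q = block_diag K B" and ev: "eigenvalue (B * B) \<mu>"
  shows "eigenvalue (F * F) \<mu>"
proof -
  have KK: "K * K \<in> carrier_mat k k" and BB: "B * B \<in> carrier_mat m m"
    and FF: "F * F \<in> carrier_mat (k + m) (k + m)"
    using K B F by simp_all
  have "char_poly (F * F) = char_poly (block_diag K B * block_diag K B)"
    using char_poly_similar[OF square_congruence[OF Q F]] unfolding eq by (rule sym)
  also have "\<dots> = char_poly (K * K) * char_poly (B * B)"
    unfolding block_diag_mult[OF K B K B] by (rule char_poly_block_diag[OF KK BB])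
  finally have "char_poly (F * F) = char_poly (K * K) * char_poly (B * B)" .
  moreover have "poly (char_poly (B * B)) \<mu> = 0"
    using ev eigenvalue_root_char_poly[OF BB] by simp
  ultimately show ?thesis
    using eigenvalue_root_char_poly[OF FF] by simp
qed

lemma transpose_skew_square:
  assumes "F \<in> skew_mats N"
  shows "transpose_mat (F * F) = F * F"
  using skew_matsD[OF assms] by (simp add: transpose_mult[of _ N N _ N])

lemma skew_square_scalar_prod:
  assumes F: "F \<in> skew_mats N" and x: "x \<in> carrier_vec N"
  shows "x \<bullet> ((F * F) *\<^sub>v x) = - ((F *\<^sub>v x) \<bullet> (F *\<^sub>v x))"
  using skew_scalar_prod[OF F x, of "F *\<^sub>v x"] skew_matsD(1)[OF F] x by simp

text \<open>Since x.(F^2 x) = -|Fx|^2, every eigenvalue of \<open>F * F\<close> is nonpositive and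
  can be written -b^2. The least of them gives the largest \<open>b\<close>, which has to head a
  decreasing list.\<close>

lemma least_eigenvalue_square:
  assumes F: "F \<in> skew_mats N" and N: "N > 0"
  obtains b x where "b \<ge> 0" "x \<in> carrier_vec N" "x \<bullet> x = 1" "F *\<^sub>v (F *\<^sub>v x) = (- b\<^sup>2) \<cdot>\<^sub>v x"
    "eigenvalue (F * F) (- b\<^sup>2)" "\<forall>c \<ge> 0. eigenvalue (F * F) (- c\<^sup>2) \<longrightarrow> c \<le> b"
proof -
  note F' = skew_matsD[OF F]
  have FF: "F * F \<in> carrier_mat N N" using F' by simp
  let ?S = "spectrum (F * F)"
  have fin: "finite ?S" by (rule card_finite_spectrum(1)[OF FF])
  have ne: "?S \<noteq> {}"
    using symmetric_has_eigenvalue[OF FF transpose_skew_square[OF F] N] by (auto simp: spectrum_def)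
  define \<mu> where "\<mu> = Min ?S"
  have ev: "eigenvalue (F * F) \<mu>" using Min_in[OF fin ne] by (simp add: \<mu>_def spectrum_def)
  have least: "\<mu> \<le> \<nu>" if "eigenvalue (F * F) \<nu>" for \<nu>
    using Min_le[OF fin, of \<nu>] that by (simp add: \<mu>_def spectrum_def)
  obtain v where v: "v \<in> carrier_vec N" "v \<noteq> 0\<^sub>v N" "(F * F) *\<^sub>v v = \<mu> \<cdot>\<^sub>v v"
    using ev F' by (auto simp: eigenvalue_def eigenvector_def)
  have pos: "v \<bullet> v > 0" by (rule scalar_prod_self_pos[OF v(1,2)])
  have "\<mu> * (v \<bullet> v) = - ((F *\<^sub>v v) \<bullet> (F *\<^sub>v v))"
    using skew_square_scalar_prod[OF F v(1)] v by simp
  moreover have "(F *\<^sub>v v) \<bullet> (F *\<^sub>v v) \<ge> 0"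
    using F' v by (simp add: scalar_prod_def sum_nonneg)
  ultimately have "\<mu> * (v \<bullet> v) \<le> 0" by simp
  with pos have "\<mu> \<le> 0" by (simp add: mult_le_0_iff)
  define b where "b = sqrt (- \<mu>)"
  have b: "b \<ge> 0" "- b\<^sup>2 = \<mu>" using \<open>\<mu> \<le> 0\<close> by (simp_all add: b_def)
  define x where "x = (1 / sqrt (v \<bullet> v)) \<cdot>\<^sub>v v"
  have x: "x \<in> carrier_vec N" using v by (simp add: x_def)
  have xx: "x \<bullet> x = 1" using pos v by (simp add: x_def)
  have FFx: "F *\<^sub>v (F *\<^sub>v x) = (- b\<^sup>2) \<cdot>\<^sub>v x"
  proof -
    have "F *\<^sub>v (F *\<^sub>v x) = (F * F) *\<^sub>v x" using F' x by simp
    also have "\<dots> = (1 / sqrt (v \<bullet> v)) \<cdot>\<^sub>v ((F * F) *\<^sub>v v)"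
      unfolding x_def by (rule mult_mat_vec[OF FF v(1)])
    also have "\<dots> = (- b\<^sup>2) \<cdot>\<^sub>v x"
      unfolding v(3) b x_def using v(1) by (intro eq_vecI) auto
    finally show ?thesis .
  qed
  have le: "\<forall>c \<ge> 0. eigenvalue (F * F) (- c\<^sup>2) \<longrightarrow> c \<le> b"
  proof (intro allI impI power2_le_imp_le[OF _ b(1)])
    fix c assume "eigenvalue (F * F) (- c\<^sup>2)"
    from least[OF this] show "c\<^sup>2 \<le> b\<^sup>2" using b(2) by linarith
  qed
  show ?thesis by (rule that[OF b(1) x xx FFx ev[folded b(2)] le])
qed

text \<open>The eigenvalue clause is there for the induction: with the maximality of the first
  \<open>b\<close> it makes the list decreasing, and it forces the list to be empty once
  \<open>b = 0\<close>.\<close>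

lemma euclidean_normal_form:
  assumes "F \<in> skew_mats N"
  shows "\<exists>Q bs. pseudo_orthogonal 1 N Q \<and> Q * F * transpose_mat Q = rotation_mat N bs \<and>
    2 * length bs \<le> N \<and> sorted_wrt (\<ge>) bs \<and> (\<forall>b \<in> set bs. b > 0 \<and> eigenvalue (F * F) (- b\<^sup>2))"
  using assms
proof (induction N arbitrary: F rule: less_induct)
  case (less N)
  note F = less.prems
  note F' = skew_matsD[OF F]
  show ?case
  proof (cases "N = 0")
    case True
    have "pseudo_orthogonal 1 N (1\<^sub>m N)" by (simp add: pseudo_orthogonal_def signature_mat_one)
    moreover have "1\<^sub>m N * F * transpose_mat (1\<^sub>m N) = rotation_mat N []"
      by (rule eq_matI) (use True F'(1) in \<open>simp_all add: rotation_mat_def\<close>)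
    ultimately show ?thesis
      by (intro exI[of _ "1\<^sub>m N"] exI[of _ "[]"]) simp
  next
    case False
    then have N: "N > 0" by simp
    obtain b x where b: "b \<ge> 0" and x: "x \<in> carrier_vec N" "x \<bullet> x = 1"
      and FFx: "F *\<^sub>v (F *\<^sub>v x) = (- b\<^sup>2) \<cdot>\<^sub>v x" and ev: "eigenvalue (F * F) (- b\<^sup>2)"
      and max: "\<forall>c \<ge> 0. eigenvalue (F * F) (- c\<^sup>2) \<longrightarrow> c \<le> b"
      by (rule least_eigenvalue_square[OF F N])
    have Fx: "F *\<^sub>v x \<in> carrier_vec N" using F' x by simp
    have sq: "(F *\<^sub>v x) \<bullet> (F *\<^sub>v x) = b\<^sup>2"
      using skew_scalar_prod[OF F x(1) Fx] FFx x by simp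
    \<comment> \<open>Normalizing the remaining block is the same after a one-dimensional and after
      a two-dimensional split, so it is done once for any block \<open>K\<close>.\<close>
    have combine: "\<exists>Q bs. pseudo_orthogonal 1 N Q \<and>
        Q * F * transpose_mat Q = block_diag K (rotation_mat m bs) \<and> 2 * length bs \<le> m \<and>
        sorted_wrt (\<ge>) bs \<and> (\<forall>b \<in> set bs. b > 0 \<and> eigenvalue (F * F) (- b\<^sup>2))"
      if k: "k > 0" "N = k + m" and K: "K \<in> carrier_mat k k" and L: "pseudo_orthogonal 1 N L"
        and B: "B \<in> skew_mats m" and eq: "L * F * transpose_mat L = block_diag K B" for k m K L B
    proof -
      have "m < N" using k by simp
      from less.IH[OF this B] obtain Q bs where Q: "pseudo_orthogonal 1 m Q"
        "Q * B * transpose_mat Q = rotation_mat m bs" "2 * length bs \<le> m" "sorted_wrt (\<ge>) bs"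
        "\<And>b. b \<in> set bs \<Longrightarrow> b > 0 \<and> eigenvalue (B * B) (- b\<^sup>2)"
        by blast
      let ?Q = "block_diag (1\<^sub>m k) Q"
      have Q': "pseudo_orthogonal 1 N (?Q * L)"
        unfolding k(2)
        by (rule pseudo_orthogonal_mult[OF pseudo_orthogonal_block_diag[OF k(1) Q(1)] L[unfolded k(2)]])
      have Qc: "?Q \<in> carrier_mat N N"
        unfolding k(2) by (rule block_diag_carrier[OF one_carrier_mat pseudo_orthogonalD(1)[OF Q(1)]])
      have "(?Q * L) * F * transpose_mat (?Q * L) = block_diag K (rotation_mat m bs)"
        unfolding congruence_mult[OF pseudo_orthogonalD(1)[OF L] Qc F'(1)] eq Q(2)[symmetric]
        by (rule congruence_block_diag[OF pseudo_orthogonalD(1)[OF Q(1)] K skew_matsD(1)[OF B]])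
      moreover have "eigenvalue (F * F) (- b\<^sup>2)" if "b \<in> set bs" for b
        using eigenvalue_square_block_diag[OF L[unfolded k(2)] F'(1)[unfolded k(2)] K skew_matsD(1)[OF B] eq]
          Q(5)[OF that] by blast
      ultimately show ?thesis using Q' Q(3-5) by blast
    qed
    show ?thesis
    proof (cases "b = 0")
      case True
      have "F *\<^sub>v x = 0\<^sub>v N"
        using sq scalar_prod_self_pos[OF Fx] True by fastforce
      define m where "m = N - 1"
      have m: "N = 1 + m" using N by (simp add: m_def)
      obtain L B where LB: "pseudo_orthogonal 1 (1 + m) L" "B \<in> skew_mats m"
        "L * F * transpose_mat L = block_diag (mat 1 1 (\<lambda>(i, j). x \<bullet> (F *\<^sub>v x))) B"
        by (rule split_off_frame[of 1 1 F m "\<lambda>_. x"])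
          (use F x m \<open>F *\<^sub>v x = 0\<^sub>v N\<close> in \<open>auto simp: signature_mat_one\<close>)
      obtain Q bs where Q: "pseudo_orthogonal 1 N Q"
        "Q * F * transpose_mat Q = block_diag (mat 1 1 (\<lambda>(i, j). x \<bullet> (F *\<^sub>v x))) (rotation_mat m bs)"
        "\<forall>b \<in> set bs. b > 0 \<and> eigenvalue (F * F) (- b\<^sup>2)"
        using combine[OF _ m mat_carrier _ LB(2,3)] LB(1)[folded m] by auto
      have "bs = []"
      proof (rule ccontr)
        assume "bs \<noteq> []"
        then have hd: "hd bs > 0" "eigenvalue (F * F) (- (hd bs)\<^sup>2)" using Q(3) by simp_all
        have "hd bs \<le> b" using max hd by (meson less_imp_le)
        with hd(1) True show False by simp
      qed
      have "Q * F * transpose_mat Q = rotation_mat N []"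
        unfolding Q(2) \<open>bs = []\<close> rotation_mat_Nil m using \<open>F *\<^sub>v x = 0\<^sub>v N\<close> x
        by (intro eq_matI) (auto simp: block_diag_def)
      with Q(1) show ?thesis by (intro exI[of _ Q] exI[of _ "[]"]) simp
    next
      case False
      with b have b: "b > 0" by simp
      \<comment> \<open>x and y span a plane invariant under \<open>F\<close>; the minus sign makes
        the (0,1) entry x.Fy equal to +b.\<close>
      define y where "y = (- 1 / b) \<cdot>\<^sub>v (F *\<^sub>v x)"
      have y: "y \<in> carrier_vec N" using Fx by (simp add: y_def)
      have Fy: "F *\<^sub>v y = b \<cdot>\<^sub>v x"
        unfolding y_def mult_mat_vec[OF F'(1) Fx] FFx using b x
        by (intro eq_vecI) (auto simp: power2_eq_square)
      have Fxy: "F *\<^sub>v x = (- b) \<cdot>\<^sub>v y"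
        using b Fx by (intro eq_vecI) (auto simp: y_def)
      have yy: "y \<bullet> y = 1" using sq b Fx by (simp add: y_def power2_eq_square)
      have "x \<bullet> (F *\<^sub>v x) = 0" by (rule skew_scalar_prod_self[OF F x(1)])
      then have xy: "x \<bullet> y = 0" using x Fx by (simp add: y_def)
      then have yx: "y \<bullet> x = 0" using comm_scalar_prod[OF x(1) y] by simp
      \<comment> \<open>Two orthonormal vectors need two dimensions; without this the truncated
        \<open>N - 2\<close> would not be the size of the remaining block.\<close>
      have "N \<noteq> 1"
      proof
        assume "N = 1"
        then have "(x $ 0) * (x $ 0) = 1" "x $ 0 * y $ 0 = 0" "y $ 0 * y $ 0 = 1"
          using x(2) xy yy x(1) y by (simp_all add: scalar_prod_def)
        then show False by auto
      qed
      define m where "m = N - 2"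
      have m: "N = 2 + m" using N \<open>N \<noteq> 1\<close> by (simp add: m_def)
      define e where "e = (\<lambda>i :: nat. if i = 0 then x else y)"
      have 2: "i < 2 \<longleftrightarrow> i = 0 \<or> i = 1" for i :: nat by auto
      obtain L B where LB: "pseudo_orthogonal 1 (2 + m) L" "B \<in> skew_mats m"
        "L * F * transpose_mat L = block_diag (mat 2 2 (\<lambda>(i, j). e i \<bullet> (F *\<^sub>v e j))) B"
      proof (rule split_off_frame[of 1 2 F m e])
        fix z i assume z: "(i :: nat) < 2" "z \<in> carrier_vec (2 + m)"
          "\<And>j. j < 2 \<Longrightarrow> z \<bullet> (signature_mat 1 (2 + m) *\<^sub>v e j) = 0"
        have "z \<bullet> x = 0" "z \<bullet> y = 0"
          using z(3)[of 0] z(3)[of 1] x y m by (simp_all add: e_def signature_mat_one)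
        then show "z \<bullet> (F *\<^sub>v e i) = 0"
          using z(2) x y m by (simp add: e_def Fy Fxy)
      qed (use F x y xy yx yy m in \<open>auto simp: signature_mat_one e_def 2\<close>)
      have K: "mat 2 2 (\<lambda>(i, j). e i \<bullet> (F *\<^sub>v e j)) = plane_block b"
        by (rule eq_matI) (use x y xy yx yy in \<open>auto simp: plane_block_def e_def 2 Fy Fxy dx_wedge_def\<close>)
      obtain Q bs where Q: "pseudo_orthogonal 1 N Q"
        "Q * F * transpose_mat Q = block_diag (plane_block b) (rotation_mat m bs)" "2 * length bs \<le> m"
        "sorted_wrt (\<ge>) bs" "\<forall>b \<in> set bs. b > 0 \<and> eigenvalue (F * F) (- b\<^sup>2)"
        using combine[OF _ m mat_carrier _ LB(2,3)] LB(1) unfolding m[symmetric] K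
        by (metis zero_less_numeral)
      have "Q * F * transpose_mat Q = rotation_mat N (b # bs)"
        unfolding Q(2) m rotation_mat_Cons ..
      moreover have "\<forall>c \<in> set (b # bs). c > 0 \<and> eigenvalue (F * F) (- c\<^sup>2)"
        using Q(5) b ev by simp
      moreover have "sorted_wrt (\<ge>) (b # bs)"
        using Q(4,5) max by (auto simp: less_imp_le)
      ultimately show ?thesis
        using Q(1,3) m by (intro exI[of _ Q] exI[of _ "b # bs"]) simp
    qed
  qed
qed

text \<open>The frame contains \<open>e 0\<close>, of square \<open>s\<close>, so its complement is
  Euclidean for either sign and the remaining block falls to \<open>euclidean_normal_form\<close>.
  What is left for Minkowski space is to exhibit a frame of one, two or three vectors.\<close>

lemma frame_normal_form:
  assumes s: "s = 1 \<or> s = - 1" and k: "0 < k" and N: "N = k + m" and F: "F \<in> skew_mats N"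
    and e: "\<And>i. i < k \<Longrightarrow> e i \<in> carrier_vec N"
    and orth: "\<And>i j. i < k \<Longrightarrow> j < k \<Longrightarrow>
      e i \<bullet> (signature_mat s N *\<^sub>v e j) = signature_mat s N $$ (i, j)"
    and inv: "\<And>z i. i < k \<Longrightarrow> z \<in> carrier_vec N \<Longrightarrow>
      (\<And>j. j < k \<Longrightarrow> z \<bullet> (signature_mat s N *\<^sub>v e j) = 0) \<Longrightarrow> z \<bullet> (F *\<^sub>v e i) = 0"
  shows "\<exists>L bs. pseudo_orthogonal s N L \<and>
    L * F * transpose_mat L = block_diag (mat k k (\<lambda>(i, j). e i \<bullet> (F *\<^sub>v e j))) (rotation_mat m bs) \<and>
    2 * length bs \<le> m \<and> sorted_wrt (\<ge>) bs \<and> (\<forall>b \<in> set bs. b > 0)"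
proof -
  let ?K = "mat k k (\<lambda>(i, j). e i \<bullet> (F *\<^sub>v e j))"
  obtain L B where L: "pseudo_orthogonal s (k + m) L" and B: "B \<in> skew_mats m"
    and eq: "L * F * transpose_mat L = block_diag ?K B"
    by (rule split_off_frame[of s k F m e, OF s k F[unfolded N] e[unfolded N] orth[unfolded N] inv[unfolded N]])
  obtain Q bs where Q: "pseudo_orthogonal 1 m Q" and QB: "Q * B * transpose_mat Q = rotation_mat m bs"
    and bs: "2 * length bs \<le> m" "sorted_wrt (\<ge>) bs" "\<forall>b \<in> set bs. b > 0"
    using euclidean_normal_form[OF B] by blast
  let ?Q = "block_diag (1\<^sub>m k) Q"
  note Q' = pseudo_orthogonal_block_diag[OF k Q, of s]
  have "(?Q * L) * F * transpose_mat (?Q * L) = block_diag ?K (rotation_mat m bs)"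
    unfolding congruence_mult[OF pseudo_orthogonalD(1)[OF L] pseudo_orthogonalD(1)[OF Q'] skew_matsD(1)[OF F[unfolded N]]]
      eq QB[symmetric]
    by (rule congruence_block_diag[OF pseudo_orthogonalD(1)[OF Q] mat_carrier skew_matsD(1)[OF B]])
  then show ?thesis
    using pseudo_orthogonal_mult[OF Q' L] bs unfolding N by blast
qed

section \<open>Adapted Minkowski frames: timelike kernel vector, boost plane, null chain\<close>

definition null_block :: "real mat" where
  "null_block = mat 3 3 (\<lambda>(i, j). dx_wedge 0 1 i j + dx_wedge 1 2 i j)"

abbreviation minkowski :: "nat \<Rightarrow> real mat" where
  "minkowski N \<equiv> signature_mat (- 1) N"

lemma timelike_kernel_normal_form:
  assumes F: "F \<in> skew_mats (1 + m)" and v: "v \<in> carrier_vec (1 + m)" "F *\<^sub>v v = 0\<^sub>v (1 + m)"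
    and vv: "v \<bullet> (minkowski (1 + m) *\<^sub>v v) < 0"
  shows "\<exists>L bs. pseudo_orthogonal (- 1) (1 + m) L \<and>
    L * F * transpose_mat L = block_diag (0\<^sub>m 1 1) (rotation_mat m bs) \<and>
    2 * length bs \<le> m \<and> sorted_wrt (\<ge>) bs \<and> (\<forall>b \<in> set bs. b > 0)"
proof -
  let ?N = "1 + m" and ?G = "minkowski (1 + m)"
  define r where "r = 1 / sqrt (- (v \<bullet> (?G *\<^sub>v v)))"
  have r: "r * r * (v \<bullet> (?G *\<^sub>v v)) = - 1"
    using vv by (simp add: r_def)
  define e where "e = r \<cdot>\<^sub>v v"
  have e: "e \<in> carrier_vec ?N" using v by (simp add: e_def)
  have Gv: "?G *\<^sub>v v \<in> carrier_vec ?N" using v(1) by (rule mult_mat_vec_carrier[OF signature_mat_carrier])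
  have ee: "e \<bullet> (?G *\<^sub>v e) = - 1"
    unfolding e_def mult_mat_vec[OF signature_mat_carrier v(1)] using r v(1) Gv by simp
  have Fe: "F *\<^sub>v e = 0\<^sub>v ?N"
    unfolding e_def mult_mat_vec[OF skew_matsD(1)[OF F] v(1)] v(2) by (intro eq_vecI) auto
  have K: "mat 1 1 (\<lambda>(i, j). e \<bullet> (F *\<^sub>v e)) = 0\<^sub>m 1 1"
    unfolding Fe using e by (intro eq_matI) simp_all
  show ?thesis
    unfolding K[symmetric]
    by (rule frame_normal_form[of "- 1" 1 ?N m F "\<lambda>_. e"]) (use F e ee Fe in simp_all)
qed

text \<open>Skewness supplies the Gram matrix: \<open>f\<close> and \<open>g\<close> are orthogonal
  and their squares are opposite, so positivity of the square of \<open>g\<close> already makes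
  \<open>f\<close> timelike.\<close>

lemma boost_normal_form:
  assumes N: "N = 2 + m" and F: "F \<in> skew_mats N"
    and f: "f \<in> carrier_vec N" "g \<in> carrier_vec N" and a: "a > 0"
    and Ff: "F *\<^sub>v f = a \<cdot>\<^sub>v (minkowski N *\<^sub>v g)" and Fg: "F *\<^sub>v g = a \<cdot>\<^sub>v (minkowski N *\<^sub>v f)"
    and gg: "g \<bullet> (minkowski N *\<^sub>v g) > 0"
  shows "\<exists>L bs. pseudo_orthogonal (- 1) N L \<and>
    L * F * transpose_mat L = block_diag (plane_block a) (rotation_mat m bs) \<and>
    2 * length bs \<le> m \<and> sorted_wrt (\<ge>) bs \<and> (\<forall>b \<in> set bs. b > 0)"
proof -
  let ?G = "minkowski N"
  have G: "?G *\<^sub>v x \<in> carrier_vec N" if "x \<in> carrier_vec N" for x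
    using that by (rule mult_mat_vec_carrier[OF signature_mat_carrier])
  define r where "r = 1 / sqrt (g \<bullet> (?G *\<^sub>v g))"
  have r: "r * r * (g \<bullet> (?G *\<^sub>v g)) = 1" using gg by (simp add: r_def)
  have "f \<bullet> (F *\<^sub>v g) = - (g \<bullet> (F *\<^sub>v f))" by (rule skew_scalar_prod[OF F f])
  then have "a * (f \<bullet> (?G *\<^sub>v f) + g \<bullet> (?G *\<^sub>v g)) = 0"
    unfolding Ff Fg using f G by (simp add: distrib_left)
  then have ff: "f \<bullet> (?G *\<^sub>v f) = - (g \<bullet> (?G *\<^sub>v g))" using a by simp
  have "f \<bullet> (F *\<^sub>v f) = 0" by (rule skew_scalar_prod_self[OF F f(1)])
  then have fg: "f \<bullet> (?G *\<^sub>v g) = 0" unfolding Ff using a f G by simp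
  have gf: "g \<bullet> (?G *\<^sub>v f) = 0"
    using fg signature_scalar_prod_commute[OF f, of "- 1"] by simp
  \<comment> \<open>The sign of the second vector makes the (0,1) entry positive: it is -r^2 a <f,f>
    = r^2 a <g,g> = a.\<close>
  define e where "e = (\<lambda>i :: nat. if i = 0 then r \<cdot>\<^sub>v f else (- r) \<cdot>\<^sub>v g)"
  have e: "e 0 = r \<cdot>\<^sub>v f" "e 1 = (- r) \<cdot>\<^sub>v g" by (simp_all add: e_def)
  have ec: "e i \<in> carrier_vec N" for i using f by (simp add: e_def)
  have Ge: "?G *\<^sub>v e 0 = r \<cdot>\<^sub>v (?G *\<^sub>v f)" "?G *\<^sub>v e 1 = (- r) \<cdot>\<^sub>v (?G *\<^sub>v g)"
    unfolding e by (intro mult_mat_vec[OF signature_mat_carrier] f)+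
  have Fe: "F *\<^sub>v e 0 = (r * a) \<cdot>\<^sub>v (?G *\<^sub>v g)" "F *\<^sub>v e 1 = (- r * a) \<cdot>\<^sub>v (?G *\<^sub>v f)"
    unfolding e mult_mat_vec[OF skew_matsD(1)[OF F] f(1)] mult_mat_vec[OF skew_matsD(1)[OF F] f(2)] Ff Fg
    by (simp_all add: smult_smult_assoc)
  have two: "i < 2 \<longleftrightarrow> i = 0 \<or> i = 1" for i :: nat by auto
  have q: "e 0 \<bullet> (?G *\<^sub>v f) = - (r * (g \<bullet> (?G *\<^sub>v g)))" "e 0 \<bullet> (?G *\<^sub>v g) = 0"
    "e 1 \<bullet> (?G *\<^sub>v f) = 0" "e 1 \<bullet> (?G *\<^sub>v g) = - (r * (g \<bullet> (?G *\<^sub>v g)))"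
    using f G unfolding e by (simp_all add: ff fg gf)
  have orth: "e i \<bullet> (?G *\<^sub>v e j) = ?G $$ (i, j)" if "i < 2" "j < 2" for i j
  proof -
    have "e 0 \<bullet> (?G *\<^sub>v e 0) = - 1" "e 0 \<bullet> (?G *\<^sub>v e 1) = 0"
      "e 1 \<bullet> (?G *\<^sub>v e 0) = 0" "e 1 \<bullet> (?G *\<^sub>v e 1) = 1"
      unfolding Ge using ec[of 0] ec[of 1] f G q r by (simp_all add: mult.assoc)
    then show ?thesis using that N unfolding two by (elim disjE) simp_all
  qed
  have inv: "z \<bullet> (F *\<^sub>v e i) = 0" if "i < 2" "z \<in> carrier_vec N"
    "\<And>j. j < 2 \<Longrightarrow> z \<bullet> (?G *\<^sub>v e j) = 0" for z i
  proof -
    have "r \<noteq> 0" using r by auto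
    then have "z \<bullet> (?G *\<^sub>v f) = 0" "z \<bullet> (?G *\<^sub>v g) = 0"
      using that(3)[of 0] that(3)[of 1] that(2) f G unfolding Ge by simp_all
    then show ?thesis
      using that(1,2) f G unfolding two by (elim disjE) (simp_all add: Fe del: One_nat_def)
  qed
  have K: "mat 2 2 (\<lambda>(i, j). e i \<bullet> (F *\<^sub>v e j)) = plane_block a" (is "?K = _")
  proof (rule eq_matI)
    fix i j assume "i < dim_row (plane_block a)" "j < dim_col (plane_block a)"
    then have ij: "i < 2" "j < 2" by (simp_all add: plane_block_def)
    have "e 0 \<bullet> (F *\<^sub>v e 0) = 0" "e 0 \<bullet> (F *\<^sub>v e 1) = a"
      "e 1 \<bullet> (F *\<^sub>v e 0) = - a" "e 1 \<bullet> (F *\<^sub>v e 1) = 0"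
      unfolding Fe using ec[of 0] ec[of 1] f G q r by (simp_all add: mult_ac)
    then show "?K $$ (i, j) = plane_block a $$ (i, j)"
      using ij unfolding two by (elim disjE) (simp_all add: plane_block_def dx_wedge_def)
  qed (simp_all add: plane_block_def)
  show ?thesis
    unfolding K[symmetric] by (rule frame_normal_form[OF _ _ N F ec orth inv]) simp_all
qed

text \<open>The line of the null vector \<open>v\<close> is degenerate and cannot be split off
  alone, so the whole chain is taken. Skewness fixes all products among \<open>t\<close>,
  \<open>u\<close>, \<open>v\<close> except <t,t>: with <u,u> = l^2 one gets <t,v> = -l^2, and the
  others vanish. Adding a multiple of \<open>v\<close> to \<open>t\<close> does not change
  \<open>F *\<^sub>v t\<close>, and this freedom compensates for the unknown <t,t>.\<close>

lemma null_normal_form: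
  assumes N: "N = 3 + m" and F: "F \<in> skew_mats N"
    and c: "t \<in> carrier_vec N" "u \<in> carrier_vec N" "v \<in> carrier_vec N"
    and Ft: "F *\<^sub>v t = minkowski N *\<^sub>v u" and Fu: "F *\<^sub>v u = minkowski N *\<^sub>v v"
    and Fv: "F *\<^sub>v v = 0\<^sub>v N" and uu: "u \<bullet> (minkowski N *\<^sub>v u) > 0"
  shows "\<exists>L bs. pseudo_orthogonal (- 1) N L \<and>
    L * F * transpose_mat L = block_diag null_block (rotation_mat m bs) \<and>
    2 * length bs \<le> m \<and> sorted_wrt (\<ge>) bs \<and> (\<forall>b \<in> set bs. b > 0)"
proof -
  let ?G = "minkowski N"
  define g where "g = (\<lambda>x y. x \<bullet> (?G *\<^sub>v y))"
  have G: "?G *\<^sub>v x \<in> carrier_vec N" if "x \<in> carrier_vec N" for x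
    using that by (rule mult_mat_vec_carrier[OF signature_mat_carrier])
  have comm: "g x y = g y x" if "x \<in> carrier_vec N" "y \<in> carrier_vec N" for x y
    unfolding g_def by (rule signature_scalar_prod_commute[OF that])
  define l where "l = sqrt (g u u)"
  have l: "l > 0" "g u u = l\<^sup>2" using uu by (simp_all add: l_def g_def)
  have gtu: "g t u = 0" using skew_scalar_prod_self[OF F c(1)] by (simp add: g_def Ft)
  have guv: "g u v = 0" using skew_scalar_prod_self[OF F c(2)] by (simp add: g_def Fu)
  have gtv: "g t v = - l\<^sup>2"
    using skew_scalar_prod[OF F c(1,2)] unfolding Ft Fu l(2)[symmetric] g_def .
  have gvv: "g v v = 0"
    using skew_scalar_prod[OF F c(3,2)] c unfolding Fv Fu g_def by simp
  have gut: "g u t = 0" and gvu: "g v u = 0" and gvt: "g v t = - l\<^sup>2"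
    using gtu guv gtv comm[OF c(1,2)] comm[OF c(2,3)] comm[OF c(1,3)] by simp_all
  note gs = gtu guv gtv gvv gut gvu gvt
  define w where "w = (\<lambda>p q. p \<cdot>\<^sub>v t + q \<cdot>\<^sub>v v)"
  have wc: "w p q \<in> carrier_vec N" for p q using c by (simp add: w_def)
  have Fw: "F *\<^sub>v w p q = p \<cdot>\<^sub>v (?G *\<^sub>v u)" for p q
  proof -
    have "F *\<^sub>v w p q = p \<cdot>\<^sub>v (F *\<^sub>v t) + q \<cdot>\<^sub>v (F *\<^sub>v v)"
      unfolding w_def using c skew_matsD(1)[OF F]
      by (simp add: mult_add_distrib_mat_vec[of _ N N] mult_mat_vec[of _ N N])
    then show ?thesis unfolding Ft Fv using G[OF c(2)] by (intro eq_vecI) auto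
  qed
  have Gw: "?G *\<^sub>v w p q = p \<cdot>\<^sub>v (?G *\<^sub>v t) + q \<cdot>\<^sub>v (?G *\<^sub>v v)" for p q
    unfolding w_def using c
    by (simp add: mult_add_distrib_mat_vec[of _ N N] mult_mat_vec[of _ N N])
  have gw: "g x (w p q) = p * g x t + q * g x v" if "x \<in> carrier_vec N" for x p q
    unfolding g_def Gw using that G c by (simp add: scalar_prod_add_distrib[of _ N])
  have gw': "g (w p q) x = p * g x t + q * g x v" if "x \<in> carrier_vec N" for x p q
    using gw[OF that] comm[OF wc that] by simp
  have gsm: "g x (p \<cdot>\<^sub>v y) = p * g x y" if "x \<in> carrier_vec N" "y \<in> carrier_vec N" for x y p
    unfolding g_def using that G mult_mat_vec[OF signature_mat_carrier that(2)] by simp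
  have gsm': "g (p \<cdot>\<^sub>v y) x = p * g y x" if "x \<in> carrier_vec N" "y \<in> carrier_vec N" for x y p
    unfolding g_def using that G by simp
  \<comment> \<open>The frame is chosen with \<open>e 0 + e 2 = v / l\<close>, and \<open>\<beta>\<close> makes \<open>e 0\<close> a unit vector.\<close>
  define \<beta> where "\<beta> = (g t t / l\<^sup>2 + 1) / (2 * l)"
  define e where "e = (\<lambda>i :: nat. if i = 0 then w (1 / l) \<beta> else if i = 1 then (- 1 / l) \<cdot>\<^sub>v u
    else w (- 1 / l) (1 / l - \<beta>))"
  have e: "e 0 = w (1 / l) \<beta>" "e 1 = (- 1 / l) \<cdot>\<^sub>v u" "e 2 = w (- 1 / l) (1 / l - \<beta>)"
    by (simp_all add: e_def)
  have ec: "e i \<in> carrier_vec N" for i using c wc by (simp add: e_def)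
  have \<beta>: "g t t = 2 * l ^ 3 * \<beta> - l\<^sup>2"
    using l(1) by (simp add: \<beta>_def field_simps power2_eq_square power3_eq_cube)
  have ge: "g x (e 0) = g x t / l + \<beta> * g x v" "g x (e 1) = - (g x u / l)"
    "g x (e 2) = - (g x t / l) + (1 / l - \<beta>) * g x v" if "x \<in> carrier_vec N" for x
    unfolding e gw[OF that] gsm[OF that c(2)] by simp_all
  have e0: "g (e 0) t = g t t / l - \<beta> * l\<^sup>2" "g (e 0) u = 0" "g (e 0) v = - l"
    and e1: "g (e 1) t = 0" "g (e 1) u = - l" "g (e 1) v = 0"
    and e2: "g (e 2) t = - (g t t / l) - (1 / l - \<beta>) * l\<^sup>2" "g (e 2) u = 0" "g (e 2) v = l"
    using l(1) unfolding ge(1-3)[OF ec] comm[OF ec c(1)] comm[OF ec c(2)] comm[OF ec c(3)] ge[OF c(1)] ge[OF c(2)] ge[OF c(3)] gs l(2)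
    by (simp_all add: power2_eq_square)
  have three: "i < 3 \<longleftrightarrow> i = 0 \<or> i = 1 \<or> i = 2" for i :: nat by auto
  have orth: "g (e i) (e j) = ?G $$ (i, j)" if "i < 3" "j < 3" for i j
  proof -
    have "g (e 0) (e 0) = - 1" "g (e 0) (e 1) = 0" "g (e 0) (e 2) = 0"
      "g (e 1) (e 0) = 0" "g (e 1) (e 1) = 1" "g (e 1) (e 2) = 0"
      "g (e 2) (e 0) = 0" "g (e 2) (e 1) = 0" "g (e 2) (e 2) = 1"
      using l(1) unfolding ge[OF ec] e0 e1 e2 \<beta>
      by (simp_all add: field_simps power2_eq_square power3_eq_cube)
    then show ?thesis using that N unfolding three by (elim disjE) simp_all
  qed
  have Fe: "F *\<^sub>v e 0 = (1 / l) \<cdot>\<^sub>v (?G *\<^sub>v u)" "F *\<^sub>v e 1 = (- 1 / l) \<cdot>\<^sub>v (?G *\<^sub>v v)"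
    "F *\<^sub>v e 2 = (- 1 / l) \<cdot>\<^sub>v (?G *\<^sub>v u)"
    unfolding e Fw mult_mat_vec[OF skew_matsD(1)[OF F] c(2)] Fu by simp_all
  have xFe: "x \<bullet> (F *\<^sub>v e 0) = g x u / l" "x \<bullet> (F *\<^sub>v e 1) = - g x v / l"
    "x \<bullet> (F *\<^sub>v e 2) = - g x u / l" if "x \<in> carrier_vec N" for x
    unfolding Fe g_def using that G c by simp_all
  have inv: "z \<bullet> (F *\<^sub>v e i) = 0" if "i < 3" "z \<in> carrier_vec N"
    "\<And>j. j < 3 \<Longrightarrow> z \<bullet> (?G *\<^sub>v e j) = 0" for z i
  proof -
    have z: "g z (e 0) = 0" "g z (e 1) = 0" "g z (e 2) = 0"
      using that(3)[of 0] that(3)[of 1] that(3)[of 2] by (simp_all add: g_def)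
    have "g z u = 0" using z(2) l(1) unfolding ge[OF that(2)] by simp
    moreover have "g z (e 0) + g z (e 2) = g z v / l"
      unfolding ge[OF that(2)] by (simp add: algebra_simps)
    then have "g z v = 0" using z(1,3) l(1) by simp
    ultimately show ?thesis
      using that(1) xFe[OF that(2)] unfolding three by (elim disjE) simp_all
  qed
  have K: "mat 3 3 (\<lambda>(i, j). e i \<bullet> (F *\<^sub>v e j)) = null_block" (is "?K = _")
  proof (rule eq_matI)
    fix i j assume "i < dim_row null_block" "j < dim_col null_block"
    then have ij: "i < 3" "j < 3" by (simp_all add: null_block_def)
    have "e 0 \<bullet> (F *\<^sub>v e 0) = 0" "e 0 \<bullet> (F *\<^sub>v e 1) = 1" "e 0 \<bullet> (F *\<^sub>v e 2) = 0"
      "e 1 \<bullet> (F *\<^sub>v e 0) = - 1" "e 1 \<bullet> (F *\<^sub>v e 1) = 0" "e 1 \<bullet> (F *\<^sub>v e 2) = 1"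
      "e 2 \<bullet> (F *\<^sub>v e 0) = 0" "e 2 \<bullet> (F *\<^sub>v e 1) = - 1" "e 2 \<bullet> (F *\<^sub>v e 2) = 0"
      using l(1) unfolding xFe[OF ec] e0 e1 e2 by simp_all
    then show "?K $$ (i, j) = null_block $$ (i, j)"
      using ij unfolding three by (elim disjE) (simp_all add: null_block_def dx_wedge_def)
  qed (simp_all add: null_block_def)
  show ?thesis
    unfolding K[symmetric] by (rule frame_normal_form[OF _ _ N F ec orth[unfolded g_def] inv]) simp_all
qed

section \<open>Existence\<close>

text \<open>Diagonal of the square of \<open>rotation_mat N bs\<close>; coordinates outside the
  planes contribute zeros. The truncated \<open>N - 2\<close> is a true difference as long as
  \<open>2 * length bs \<le> N\<close>.\<close>

fun square_diag :: "nat \<Rightarrow> real list \<Rightarrow> real list" where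
  "square_diag N [] = replicate N 0"
| "square_diag N (b # bs) = - b\<^sup>2 # - b\<^sup>2 # square_diag (N - 2) bs"

definition diagonal :: "real list \<Rightarrow> real mat" where
  "diagonal ds = mat (length ds) (length ds) (\<lambda>(i, j). if i = j then ds ! i else 0)"

lemma length_square_diag: "2 * length bs \<le> N \<Longrightarrow> length (square_diag N bs) = N"
  by (induction N bs rule: square_diag.induct) auto

lemma square_diag_nonpos: "d \<in> set (square_diag N bs) \<Longrightarrow> d \<le> 0"
  by (induction N bs rule: square_diag.induct) auto

lemma rotation_mat_square:
  assumes "2 * length bs \<le> N"
  shows "rotation_mat N bs * rotation_mat N bs = diagonal (square_diag N bs)"
  using assms
proof (induction bs arbitrary: N)
  case Nil
  show ?case by (rule eq_matI) (auto simp: rotation_mat_Nil diagonal_def)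
next
  case (Cons b bs)
  define m where "m = N - 2"
  have m: "N = 2 + m" using Cons.prems by (simp add: m_def)
  have IH: "rotation_mat m bs * rotation_mat m bs = diagonal (square_diag m bs)"
    using Cons by (simp add: m)
  have len: "length (square_diag m bs) = m" using Cons.prems m by (simp add: length_square_diag)
  have two: "{0..<2} = {0, 1 :: nat}" by auto
  have R: "plane_block b * plane_block b = diagonal [- b\<^sup>2, - b\<^sup>2]" (is "?l = ?r")
  proof (rule eq_matI)
    fix i j assume "i < dim_row ?r" "j < dim_col ?r"
    then have "i = 0 \<or> i = 1" "j = 0 \<or> j = 1" by (auto simp: diagonal_def)
    then show "?l $$ (i, j) = ?r $$ (i, j)"
      by (elim disjE)
        (simp_all add: plane_block_def diagonal_def scalar_prod_def dx_wedge_def two power2_eq_square)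
  qed (simp_all add: plane_block_def diagonal_def)
  have "rotation_mat N (b # bs) * rotation_mat N (b # bs) =
      block_diag (diagonal [- b\<^sup>2, - b\<^sup>2]) (diagonal (square_diag m bs))"
    unfolding m rotation_mat_Cons
    by (simp add: block_diag_mult[of _ 2 _ m] R IH)
  also have "\<dots> = diagonal (square_diag N (b # bs))" (is "?l = ?r")
  proof (rule eq_matI)
    fix i j assume "i < dim_row ?r" "j < dim_col ?r"
    then have ij: "i < 2 + m" "j < 2 + m" using len by (simp_all add: diagonal_def m)
    have D: "diagonal [- b\<^sup>2, - b\<^sup>2] \<in> carrier_mat 2 2" "diagonal (square_diag m bs) \<in> carrier_mat m m"
      by (simp_all add: diagonal_def len numeral_2_eq_2)
    show "?l $$ (i, j) = ?r $$ (i, j)"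
      unfolding block_diag_index[OF D ij] using ij len
      by (auto simp: diagonal_def m nth_Cons less_2_cases_iff split: nat.split)
  qed (use len in \<open>simp_all add: block_diag_def diagonal_def m\<close>)
  finally show ?case .
qed

text \<open>The three alternatives correspond to a nonzero real eigenvalue, a timelike kernel
  vector (strict inequality) and a null kernel vector (equality).\<close>

lemma secular_equation_cases:
  fixes E d :: "nat \<Rightarrow> real"
  assumes d: "\<And>i. i < n \<Longrightarrow> d i \<ge> 0"
  shows "(\<exists>s > 0. (\<Sum>i<n. (E i)\<^sup>2 / (s + d i)) = 1) \<or>
    (\<forall>i < n. d i = 0 \<longrightarrow> E i = 0) \<and> (\<Sum>i<n. (E i)\<^sup>2 / d i) \<le> 1"
proof (rule disjCI)
  assume no: "\<not> ((\<forall>i < n. d i = 0 \<longrightarrow> E i = 0) \<and> (\<Sum>i<n. (E i)\<^sup>2 / d i) \<le> 1)"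
  define g where "g = (\<lambda>s. \<Sum>i<n. (E i)\<^sup>2 / (s + d i))"
  have cont: "continuous_on {0<..} g"
    unfolding g_def using d by (intro continuous_intros) (force simp: add_pos_nonneg)
  \<comment> \<open>Since g is at most 1 for large arguments, one point with value at least 1 is
    enough for the intermediate value theorem. If there is none, letting s tend to 0 gives the
    second alternative.\<close>
  have "\<exists>s > 0. g s \<ge> 1"
  proof (rule ccontr)
    assume "\<not> ?thesis"
    then have less: "g s < 1" if "s > 0" for s using that by force
    \<comment> \<open>At the test point s = E_i^2 a term with d_i = 0 would already equal 1.\<close>
    have E0: "E i = 0" if i: "i < n" "d i = 0" for i
    proof (rule ccontr)
      assume "E i \<noteq> 0"
      then have pos: "(E i)\<^sup>2 > 0" by simp
      have "(E i)\<^sup>2 / ((E i)\<^sup>2 + d i) \<le> g ((E i)\<^sup>2)"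
        unfolding g_def using d i(1)
        by (intro member_le_sum[of i _ "\<lambda>j. (E j)\<^sup>2 / ((E i)\<^sup>2 + d j)"]) auto
      with less[OF pos] i(2) pos show False by simp
    qed
    have "(\<Sum>i<n. (E i)\<^sup>2 / d i) \<le> 1"
    proof (rule tendsto_upperbound)
      show "(g \<longlongrightarrow> (\<Sum>i<n. (E i)\<^sup>2 / d i)) (at_right 0)"
        unfolding g_def
      proof (rule tendsto_sum)
        fix i assume i: "i \<in> {..<n}"
        show "((\<lambda>s. (E i)\<^sup>2 / (s + d i)) \<longlongrightarrow> (E i)\<^sup>2 / d i) (at_right 0)"
        proof (cases "d i = 0")
          \<comment> \<open>The limit relies on x / 0 = 0: where d_i = 0 also E_i = 0, so the
            summand is identically 0.\<close>
          case True
          then show ?thesis using E0[of i] i by simp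
        next
          case False
          have "((\<lambda>s. (E i)\<^sup>2 / (s + d i)) \<longlongrightarrow> (E i)\<^sup>2 / (0 + d i)) (at_right 0)"
            using False by (intro tendsto_intros) auto
          then show ?thesis by simp
        qed
      qed
      show "\<forall>\<^sub>F s in at_right 0. g s \<le> 1"
        using less by (auto simp: eventually_at_right_field intro!: exI[of _ 1] less_imp_le)
    qed simp
    with no E0 show False by blast
  qed
  then obtain s where s: "s > 0" "g s \<ge> 1" by blast
  \<comment> \<open>Large enough that g(S) is at most the sum of the E_i^2 / S, hence at most 1; the
    summand s + 1 puts S beyond s.\<close>
  define S where "S = s + (\<Sum>i<n. (E i)\<^sup>2) + 1"
  have S: "S > s" "S > 0" unfolding S_def using s(1)
    by (simp_all add: add_pos_nonneg add_nonneg_pos sum_nonneg)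
  have "g S \<le> (\<Sum>i<n. (E i)\<^sup>2 / S)"
    unfolding g_def using d S by (intro sum_mono divide_left_mono mult_pos_pos) (auto simp: add_pos_nonneg)
  also have "\<dots> \<le> 1" using S(2) s(1) unfolding sum_divide_distrib[symmetric] by (simp add: S_def)
  finally have "g S \<le> 1" .
  have "\<exists>x \<ge> s. x \<le> S \<and> g x = 1"
    using s S \<open>g S \<le> 1\<close> by (intro IVT2') (auto intro: continuous_on_subset[OF cont])
  then show "\<exists>s > 0. (\<Sum>i<n. (E i)\<^sup>2 / (s + d i)) = 1"
    using s(1) unfolding g_def by (meson less_le_trans)
qed

text \<open>The 2-form with electric field \<open>E\<close> and magnetic part \<open>B\<close>.\<close>

definition field_mat :: "real vec \<Rightarrow> real mat \<Rightarrow> real mat" where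
  "field_mat E B = mat (Suc (dim_vec E)) (Suc (dim_vec E)) (\<lambda>(i, j).
     if i = 0 then (if j = 0 then 0 else - E $ (j - 1))
     else (if j = 0 then E $ (i - 1) else B $$ (i - 1, j - 1)))"

lemma field_mat_mult_vec:
  assumes "E \<in> carrier_vec n" "B \<in> carrier_mat n n" "p \<in> carrier_vec n"
  shows "field_mat E B *\<^sub>v vCons \<tau> p = vCons (- (E \<bullet> p)) (\<tau> \<cdot>\<^sub>v E + B *\<^sub>v p)"
proof (rule eq_vecI)
  fix i assume "i < dim_vec (vCons (- (E \<bullet> p)) (\<tau> \<cdot>\<^sub>v E + B *\<^sub>v p))"
  then have i: "i < Suc n" using assms by simp
  show "(field_mat E B *\<^sub>v vCons \<tau> p) $ i = vCons (- (E \<bullet> p)) (\<tau> \<cdot>\<^sub>v E + B *\<^sub>v p) $ i"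
  proof (cases i)
    case 0
    then show ?thesis
      using assms by (auto simp: field_mat_def scalar_prod_def sum.atLeast0_lessThan_Suc_shift sum_negf
        simp del: sum.op_ivl_Suc)
  next
    case (Suc k)
    then show ?thesis
      using assms i by (auto simp: field_mat_def scalar_prod_def sum.atLeast0_lessThan_Suc_shift
        simp del: sum.op_ivl_Suc)
  qed
qed (use assms in \<open>simp add: field_mat_def\<close>)

lemma signature_mat_mult_vCons:
  assumes "p \<in> carrier_vec n"
  shows "signature_mat s (Suc n) *\<^sub>v vCons \<tau> p = vCons (s * \<tau>) p"
proof (rule eq_vecI)
  fix i assume "i < dim_vec (vCons (s * \<tau>) p)"
  then show "(signature_mat s (Suc n) *\<^sub>v vCons \<tau> p) $ i = vCons (s * \<tau>) p $ i"
    using assms by (subst signature_mat_vec_index) (auto simp: vec_index_vCons)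
qed (use assms in simp)

lemma skew_mat_eq_field_mat:
  assumes F: "F \<in> skew_mats (Suc n)"
  shows "F = field_mat (vec n (\<lambda>i. F $$ (Suc i, 0))) (mat n n (\<lambda>(i, j). F $$ (Suc i, Suc j)))"
    and "mat n n (\<lambda>(i, j). F $$ (Suc i, Suc j)) \<in> skew_mats n"
proof -
  note F' = skew_matsD[OF F]
  have sk: "F $$ (i, j) = - F $$ (j, i)" if "i < Suc n" "j < Suc n" for i j
    using arg_cong[OF F'(2), of "\<lambda>A. A $$ (j, i)"] F'(1) that by simp
  show "F = field_mat (vec n (\<lambda>i. F $$ (Suc i, 0))) (mat n n (\<lambda>(i, j). F $$ (Suc i, Suc j)))" (is "_ = ?R")
  proof (rule eq_matI)
    fix i j assume "i < dim_row ?R" "j < dim_col ?R"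
    then have ij: "i < Suc n" "j < Suc n" by (simp_all add: field_mat_def)
    have "F $$ (0, 0) = 0" using sk[of 0 0] by simp
    then show "F $$ (i, j) = ?R $$ (i, j)"
      using ij sk[of 0 j] by (cases i; cases j) (simp_all add: field_mat_def)
  qed (use F'(1) in \<open>simp_all add: field_mat_def\<close>)
  have "transpose_mat (mat n n (\<lambda>(i, j). F $$ (Suc i, Suc j))) = - mat n n (\<lambda>(i, j). F $$ (Suc i, Suc j))"
    by (rule eq_matI) (simp_all add: sk[symmetric])
  then show "mat n n (\<lambda>(i, j). F $$ (Suc i, Suc j)) \<in> skew_mats n"
    by (simp add: skew_mats_def)
qed

text \<open>A spatial rotation \<open>block_diag (1\<^sub>m 1) Q\<close> fixes the time axis, so it
  acts on the magnetic part through \<open>Q\<close> alone, with no admixture of the electric field,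
  which stays arbitrary.\<close>

lemma magnetic_normal_form:
  assumes F: "F \<in> skew_mats (Suc n)"
  obtains L E bs where "pseudo_orthogonal (- 1) (Suc n) L" "E \<in> carrier_vec n" "2 * length bs \<le> n"
    "L * F * transpose_mat L = field_mat E (rotation_mat n bs)" "rotation_mat n bs \<in> skew_mats n"
proof -
  define B where "B = mat n n (\<lambda>(i, j). F $$ (Suc i, Suc j))"
  define E where "E = vec n (\<lambda>i. F $$ (Suc i, 0))"
  have FE: "F = field_mat E B" and B: "B \<in> skew_mats n"
    unfolding E_def B_def using skew_mat_eq_field_mat[OF F] by simp_all
  have E: "E \<in> carrier_vec n" by (simp add: E_def)
  obtain Q bs where Q: "pseudo_orthogonal 1 n Q" and QB: "Q * B * transpose_mat Q = rotation_mat n bs"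
    and bs: "2 * length bs \<le> n"
    using euclidean_normal_form[OF B] by blast
  note Qc = pseudo_orthogonalD(1)[OF Q]
  let ?L = "block_diag (1\<^sub>m 1) Q"
  have L: "pseudo_orthogonal (- 1) (Suc n) ?L"
    using pseudo_orthogonal_block_diag[of 1, OF _ Q, of "- 1"] by simp
  note Lc = pseudo_orthogonalD(1)[OF L]
  let ?M = "?L * F * transpose_mat ?L"
  have M: "?M \<in> skew_mats (Suc n)" by (rule congruence_skew[OF Lc F])
  have row: "row ?L (Suc i) = vCons 0 (row Q i)" if "i < n" for i
  proof (rule eq_vecI)
    fix j assume "j < dim_vec (vCons 0 (row Q i))"
    then have "j < Suc n" using Qc by simp
    then show "row ?L (Suc i) $ j = vCons 0 (row Q i) $ j"
      using that Qc by (cases j) (auto simp: block_diag_def)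
  qed (use Qc in \<open>simp add: block_diag_def\<close>)
  have "mat n n (\<lambda>(i, j). ?M $$ (Suc i, Suc j)) = rotation_mat n bs"
  proof (rule eq_matI)
    fix i j assume "i < dim_row (rotation_mat n bs)" "j < dim_col (rotation_mat n bs)"
    then have ij: "i < n" "j < n" by (simp_all add: rotation_mat_def)
    have ri: "row Q i \<in> carrier_vec n" "row Q j \<in> carrier_vec n" using Qc ij by auto
    have "?M $$ (Suc i, Suc j) = row ?L (Suc i) \<bullet> (F *\<^sub>v row ?L (Suc j))"
      by (rule congruence_index[OF Lc skew_matsD(1)[OF F]]) (use ij in simp_all)
    also have "\<dots> = row Q i \<bullet> (0 \<cdot>\<^sub>v E + B *\<^sub>v row Q j)"
      unfolding row[OF ij(1)] row[OF ij(2)] FE field_mat_mult_vec[OF E skew_matsD(1)[OF B] ri(2)]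
      by simp
    also have "row Q i \<bullet> (0 \<cdot>\<^sub>v E + B *\<^sub>v row Q j) = row Q i \<bullet> (B *\<^sub>v row Q j)"
      using E skew_matsD(1)[OF B] by (intro arg_cong[of _ _ "scalar_prod (row Q i)"] eq_vecI) auto
    also have "\<dots> = rotation_mat n bs $$ (i, j)"
      unfolding QB[symmetric] by (rule congruence_index[OF Qc skew_matsD(1)[OF B] ij, symmetric])
    finally show "mat n n (\<lambda>(i, j). ?M $$ (Suc i, Suc j)) $$ (i, j) = rotation_mat n bs $$ (i, j)"
      using ij by simp
  qed (simp_all add: rotation_mat_def)
  then show ?thesis
    using that[OF L _ bs, of "vec n (\<lambda>i. ?M $$ (Suc i, 0))"] skew_mat_eq_field_mat[OF M] by simp
qed

lemma smult_vCons: "a \<cdot>\<^sub>v vCons b v = vCons (a * b) (a \<cdot>\<^sub>v v)"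
  by (rule eq_vecI) (auto simp: vec_index_vCons)

lemma zero_smult_add_vec:
  fixes E p :: "real vec"
  assumes "E \<in> carrier_vec n" "p \<in> carrier_vec n"
  shows "0 \<cdot>\<^sub>v E + p = p"
  using assms by (intro eq_vecI) auto

lemma diagonal_mult_vec:
  assumes "v \<in> carrier_vec (length ds)"
  shows "diagonal ds *\<^sub>v v = vec (length ds) (\<lambda>i. ds ! i * v $ i)"
proof (rule eq_vecI)
  fix i assume i: "i < dim_vec (vec (length ds) (\<lambda>i. ds ! i * v $ i))"
  have "(diagonal ds *\<^sub>v v) $ i = (\<Sum>j = 0..<length ds. (if i = j then ds ! i else 0) * v $ j)"
    using i assms by (simp add: diagonal_def scalar_prod_def)
  also have "\<dots> = (\<Sum>j = 0..<length ds. if j = i then ds ! i * v $ i else 0)"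
    by (intro sum.cong) auto
  also have "\<dots> = vec (length ds) (\<lambda>i. ds ! i * v $ i) $ i" using i by simp
  finally show "(diagonal ds *\<^sub>v v) $ i = vec (length ds) (\<lambda>i. ds ! i * v $ i) $ i" .
qed (simp add: diagonal_def)

lemma field_mat_normal_form:
  assumes n: "n \<ge> 1" and E: "E \<in> carrier_vec n" and B: "B \<in> skew_mats n"
    and F: "field_mat E B \<in> skew_mats (Suc n)"
    and BB: "B * B = diagonal ds" and ds: "length ds = n" "\<And>d. d \<in> set ds \<Longrightarrow> d \<le> 0"
  shows "\<exists>L k m K bs. pseudo_orthogonal (- 1) (Suc n) L \<and> Suc n = k + m \<and>
    L * field_mat E B * transpose_mat L = block_diag K (rotation_mat m bs) \<and>
    2 * length bs \<le> m \<and> sorted_wrt (\<ge>) bs \<and> (\<forall>b \<in> set bs. b > 0) \<and>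
    (K = 0\<^sub>m 1 1 \<and> k = 1 \<or> (\<exists>a > 0. K = plane_block a \<and> k = 2) \<or> K = null_block \<and> k = 3)"
    (is "\<exists>L k m K bs. ?P L k m K bs")
proof -
  let ?N = "Suc n" and ?F = "field_mat E B"
  note Bc = skew_matsD(1)[OF B]
  note mult_F = field_mat_mult_vec[OF E Bc]
  define d where "d = (\<lambda>i. - ds ! i)"
  have d: "d i \<ge> 0" if "i < n" for i using ds that by (simp add: d_def)
  have BBv: "B *\<^sub>v (B *\<^sub>v v) = vec n (\<lambda>i. - d i * v $ i)" if v: "v \<in> carrier_vec n" for v
  proof -
    have "B *\<^sub>v (B *\<^sub>v v) = diagonal ds *\<^sub>v v"
      using assoc_mult_mat_vec[OF Bc Bc v] unfolding BB by simp
    then show ?thesis using diagonal_mult_vec[of v ds] v ds(1) by (simp add: d_def)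
  qed
  have Bv: "B *\<^sub>v v \<in> carrier_vec n" if "v \<in> carrier_vec n" for v
    by (rule mult_mat_vec_carrier[OF Bc that])
  have Bself: "(B *\<^sub>v v) \<bullet> v = 0" if "v \<in> carrier_vec n" for v
    using skew_scalar_prod_self[OF B that] comm_scalar_prod[OF Bv[OF that] that] by simp
  have Bskew: "(B *\<^sub>v v) \<bullet> w = - (v \<bullet> (B *\<^sub>v w))" if "v \<in> carrier_vec n" "w \<in> carrier_vec n" for v w
    using skew_scalar_prod[OF B that] comm_scalar_prod[OF Bv[OF that(1)] that(2)] by simp
  note mult_G = signature_mat_mult_vCons[of _ n "- 1"]
  consider s where "s > 0" "(\<Sum>i<n. (E $ i)\<^sup>2 / (s + d i)) = 1"
    | "\<forall>i < n. d i = 0 \<longrightarrow> E $ i = 0" "(\<Sum>i<n. (E $ i)\<^sup>2 / d i) \<le> 1"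
    using secular_equation_cases[of n d "\<lambda>i. E $ i"] d by blast
  then show ?thesis
  proof cases
    case (1 s)
    define a where "a = sqrt s"
    have a: "a > 0" "s = a\<^sup>2" using 1 by (simp_all add: a_def)
    \<comment> \<open>z = (s - B^2)^-1 E, as the eigenvalue equation prescribes; the secular
      equation becomes E.z = 1.\<close>
    define z where "z = vec n (\<lambda>i. E $ i / (s + d i))"
    have z: "z \<in> carrier_vec n" by (simp add: z_def)
    have Ezi: "E $ i = s * z $ i + d i * z $ i" if i: "i < n" for i
    proof -
      have "s + d i > 0" using d[OF i] 1(1) by simp
      then have "E $ i = (s + d i) * z $ i" using i by (simp add: z_def)
      then show ?thesis by (simp add: distrib_right)
    qed
    define p where "p = B *\<^sub>v z"
    have p: "p \<in> carrier_vec n" unfolding p_def by (rule Bv[OF z])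
    have Bp: "B *\<^sub>v p = vec n (\<lambda>i. - d i * z $ i)" unfolding p_def by (rule BBv[OF z])
    have Bpc: "B *\<^sub>v p \<in> carrier_vec n" by (rule Bv[OF p])
    \<comment> \<open>Once E is written through z and p = Bz, the product E.p vanishes by skewness
      of B alone.\<close>
    have Ez: "E = s \<cdot>\<^sub>v z - B *\<^sub>v p"
      unfolding Bp using E z Ezi by (intro eq_vecI) simp_all
    have dotz: "E \<bullet> z = 1"
      using 1(2) E by (simp add: scalar_prod_def z_def power2_eq_square atLeast0LessThan)
    have "(s \<cdot>\<^sub>v z - B *\<^sub>v p) \<bullet> p = s * (z \<bullet> p) - (B *\<^sub>v p) \<bullet> p"
      using z p Bpc by (simp add: minus_scalar_prod_distrib[of _ n])
    also have "\<dots> = 0"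
      using skew_scalar_prod_self[OF B z] Bself[OF p] by (simp add: p_def)
    finally have dotB: "E \<bullet> p = 0" unfolding Ez[symmetric] .
    have zz: "z \<bullet> z > 0"
      using scalar_prod_self_pos[OF z] dotz E by fastforce
    define f where "f = vCons 1 p"
    define g where "g = vCons 0 (a \<cdot>\<^sub>v z)"
    have az: "a \<cdot>\<^sub>v z \<in> carrier_vec n" using z by simp
    have fg: "f \<in> carrier_vec ?N" "g \<in> carrier_vec ?N" using az p by (simp_all add: f_def g_def)
    have "1 \<cdot>\<^sub>v E + B *\<^sub>v p = a \<cdot>\<^sub>v (a \<cdot>\<^sub>v z)"
      unfolding Bp using E z Ezi a(2) by (intro eq_vecI) (simp_all add: power2_eq_square)
    then have Ff: "?F *\<^sub>v f = a \<cdot>\<^sub>v (minkowski ?N *\<^sub>v g)"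
      unfolding f_def g_def mult_F[OF p] mult_G[OF az] dotB smult_vCons by simp
    have "0 \<cdot>\<^sub>v E + B *\<^sub>v (a \<cdot>\<^sub>v z) = a \<cdot>\<^sub>v p"
      unfolding mult_mat_vec[OF Bc z] p_def[symmetric] using E p by (intro zero_smult_add_vec) simp_all
    then have Fg: "?F *\<^sub>v g = a \<cdot>\<^sub>v (minkowski ?N *\<^sub>v f)"
      unfolding f_def g_def mult_F[OF az] mult_G[OF p] smult_vCons
      using dotz E z by simp
    have gg: "g \<bullet> (minkowski ?N *\<^sub>v g) > 0"
      unfolding g_def mult_G[OF az] using z zz a(1) by simp
    have N: "?N = 2 + (n - 1)" using n by simp
    from boost_normal_form[OF N F fg a(1) Ff Fg gg] obtain L bs where
      "pseudo_orthogonal (- 1) ?N L"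
      "L * ?F * transpose_mat L = block_diag (plane_block a) (rotation_mat (n - 1) bs)"
      "2 * length bs \<le> n - 1" "sorted_wrt (\<ge>) bs" "\<forall>b \<in> set bs. b > 0"
      by blast
    then have "?P L 2 (n - 1) (plane_block a) bs" using a(1) N by blast
    then show ?thesis by blast
  next
    case 2
    \<comment> \<open>The case s = 0 of the same formula. Where d_i = 0 the convention x / 0 = 0
      gives z_i = 0, which is right because E_i = 0 there: E_i = d_i z_i holds in every
      coordinate.\<close>
    define z where "z = vec n (\<lambda>i. E $ i / d i)"
    have z: "z \<in> carrier_vec n" by (simp add: z_def)
    have Ezi: "E $ i = d i * z $ i" if "i < n" for i
      using that 2(1) by (cases "d i = 0") (simp_all add: z_def)
    define p where "p = B *\<^sub>v z"
    have p: "p \<in> carrier_vec n" unfolding p_def by (rule Bv[OF z])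
    have Bp: "B *\<^sub>v p = - E"
      unfolding p_def BBv[OF z] using E Ezi by (intro eq_vecI) simp_all
    have dotz: "E \<bullet> z = (\<Sum>i<n. (E $ i)\<^sup>2 / d i)"
      using E by (simp add: scalar_prod_def z_def power2_eq_square atLeast0LessThan)
    have "(- E) \<bullet> p = 0" unfolding Bp[symmetric] by (rule Bself[OF p])
    then have dotB: "E \<bullet> p = 0" using E p by simp
    define v where "v = vCons 1 p"
    have v: "v \<in> carrier_vec ?N" using p by (simp add: v_def)
    have "1 \<cdot>\<^sub>v E + - E = 0\<^sub>v n" using E by (intro eq_vecI) simp_all
    then have Fv: "?F *\<^sub>v v = 0\<^sub>v ?N"
      unfolding v_def mult_F[OF p] Bp dotB by (simp add: zero_vec_Suc)
    \<comment> \<open>Moving B across the product turns |Bz|^2 into E.z, so the kernel vector (1, p)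
      has square E.z - 1, which is at most 0.\<close>
    have "p \<bullet> p = - (z \<bullet> (B *\<^sub>v p))" using Bskew[OF z p] by (simp add: p_def)
    then have pp: "p \<bullet> p = E \<bullet> z"
      unfolding Bp using E z comm_scalar_prod[OF E z] by simp
    then have vv: "v \<bullet> (minkowski ?N *\<^sub>v v) = - 1 + E \<bullet> z"
      unfolding v_def mult_G[OF p] by simp
    show ?thesis
    proof (cases "E \<bullet> z = 1")
      case False
      then have neg: "v \<bullet> (minkowski ?N *\<^sub>v v) < 0" using vv 2(2) dotz by simp
      have N: "?N = 1 + n" by simp
      from timelike_kernel_normal_form[of ?F n v] F v Fv neg obtain L bs where
        "pseudo_orthogonal (- 1) ?N L"
        "L * ?F * transpose_mat L = block_diag (0\<^sub>m 1 1) (rotation_mat n bs)"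
        "2 * length bs \<le> n" "sorted_wrt (\<ge>) bs" "\<forall>b \<in> set bs. b > 0"
        unfolding N by blast
      then have "?P L 1 n (0\<^sub>m 1 1) bs" using N by blast
      then show ?thesis by blast
    next
      case True
      \<comment> \<open>One more inversion of B^2: z vanishes wherever d does, so z = -B^2 y, and q
        = -By solves Bq = z, which starts the chain.\<close>
      define y where "y = vec n (\<lambda>i. z $ i / d i)"
      have y: "y \<in> carrier_vec n" by (simp add: y_def)
      define q where "q = - (B *\<^sub>v y)"
      have q: "q \<in> carrier_vec n" unfolding q_def using Bv[OF y] by simp
      have zi: "z $ i = d i * y $ i" if "i < n" for i
        using that by (cases "d i = 0") (simp_all add: y_def z_def)
      have "B *\<^sub>v q = - (B *\<^sub>v (B *\<^sub>v y))"
        unfolding q_def using Bc Bv[OF y] by (intro eq_vecI) (auto simp: scalar_prod_def sum_negf)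
      also have "\<dots> = z" unfolding BBv[OF y] using z zi by (intro eq_vecI) simp_all
      finally have Bq: "B *\<^sub>v q = z" .
      have zz: "z \<bullet> z > 0"
        using scalar_prod_self_pos[OF z] True E by fastforce
      have "(- E) \<bullet> q = - (p \<bullet> z)" unfolding Bp[symmetric] Bskew[OF p q] Bq ..
      also have "\<dots> = 0" using Bself[OF z] by (simp add: p_def)
      finally have dotq: "E \<bullet> q = 0" using E q by simp
      define t where "t = vCons 0 q"
      define u where "u = vCons 0 z"
      have tu: "t \<in> carrier_vec ?N" "u \<in> carrier_vec ?N" using q z by (simp_all add: t_def u_def)
      have Ft: "?F *\<^sub>v t = minkowski ?N *\<^sub>v u"
        unfolding t_def u_def mult_F[OF q] mult_G[OF z] dotq Bq zero_smult_add_vec[OF E z] by simp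
      have Fu: "?F *\<^sub>v u = minkowski ?N *\<^sub>v v"
        unfolding v_def u_def mult_F[OF z] mult_G[OF p] True p_def[symmetric] zero_smult_add_vec[OF E p] by simp
      have uu: "u \<bullet> (minkowski ?N *\<^sub>v u) > 0"
        unfolding u_def mult_G[OF z] using zz by simp
      \<comment> \<open>For n = 1 a skew B is zero, so p = Bz = 0 against p.p = 1; hence there is
        room for a block of size 3.\<close>
      have "n \<noteq> 1"
      proof
        assume n1: "n = 1"
        have "B $$ (0, 0) = 0"
          using arg_cong[OF skew_matsD(2)[OF B], of "\<lambda>A. A $$ (0, 0)"] Bc n1 by simp
        then have "p $ 0 = 0" using Bc n1 z by (simp add: p_def scalar_prod_def)
        then have "p \<bullet> p = 0" using p n1 by (simp add: scalar_prod_def)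
        then show False using pp True by simp
      qed
      then have N: "?N = 3 + (n - 2)" using n by simp
      from null_normal_form[OF N F tu v Ft Fu Fv uu] obtain L bs where
        "pseudo_orthogonal (- 1) ?N L"
        "L * ?F * transpose_mat L = block_diag null_block (rotation_mat (n - 2) bs)"
        "2 * length bs \<le> n - 2" "sorted_wrt (\<ge>) bs" "\<forall>b \<in> set bs. b > 0"
        by blast
      then have "?P L 3 (n - 2) null_block bs" using N by blast
      then show ?thesis by blast
    qed
  qed
qed

lemma lorentzian_normal_form:
  assumes n: "n \<ge> 1" and F: "F \<in> skew_mats (Suc n)"
  shows "\<exists>L k m K bs. pseudo_orthogonal (- 1) (Suc n) L \<and> Suc n = k + m \<and>
    L * F * transpose_mat L = block_diag K (rotation_mat m bs) \<and>
    2 * length bs \<le> m \<and> sorted_wrt (\<ge>) bs \<and> (\<forall>b \<in> set bs. b > 0) \<and>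
    (K = 0\<^sub>m 1 1 \<and> k = 1 \<or> (\<exists>a > 0. K = plane_block a \<and> k = 2) \<or> K = null_block \<and> k = 3)"
proof -
  obtain L E cs where L: "pseudo_orthogonal (- 1) (Suc n) L" and E: "E \<in> carrier_vec n"
    and cs: "2 * length cs \<le> n" and eq: "L * F * transpose_mat L = field_mat E (rotation_mat n cs)"
    and R: "rotation_mat n cs \<in> skew_mats n"
    by (rule magnetic_normal_form[OF F])
  have FE: "field_mat E (rotation_mat n cs) \<in> skew_mats (Suc n)"
    unfolding eq[symmetric] by (rule congruence_skew[OF pseudo_orthogonalD(1)[OF L] F])
  obtain L' k m K bs where L': "pseudo_orthogonal (- 1) (Suc n) L'"
    and rest: "Suc n = k + m" "2 * length bs \<le> m" "sorted_wrt (\<ge>) bs" "\<forall>b \<in> set bs. b > 0"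
      "K = 0\<^sub>m 1 1 \<and> k = 1 \<or> (\<exists>a > 0. K = plane_block a \<and> k = 2) \<or> K = null_block \<and> k = 3"
    and eq': "L' * field_mat E (rotation_mat n cs) * transpose_mat L' = block_diag K (rotation_mat m bs)"
    using field_mat_normal_form[OF n E R FE rotation_mat_square[OF cs] length_square_diag[OF cs] square_diag_nonpos[of _ n cs]]
    by blast
  have "(L' * L) * F * transpose_mat (L' * L) = block_diag K (rotation_mat m bs)"
    unfolding congruence_mult[OF pseudo_orthogonalD(1)[OF L] pseudo_orthogonalD(1)[OF L'] skew_matsD(1)[OF F]]
      eq eq' ..
  with pseudo_orthogonal_mult[OF L' L] rest show ?thesis by blast
qed

section \<open>Uniqueness\<close>

lemma diagonal_carrier [simp, intro]: "diagonal ds \<in> carrier_mat (length ds) (length ds)"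
  by (simp add: diagonal_def)

lemma block_diag_diagonal: "block_diag (diagonal ds) (diagonal es) = diagonal (ds @ es)"
proof (rule eq_matI)
  fix i j assume "i < dim_row (diagonal (ds @ es))" "j < dim_col (diagonal (ds @ es))"
  then have ij: "i < length ds + length es" "j < length ds + length es"
    by (simp_all add: diagonal_def)
  then show "block_diag (diagonal ds) (diagonal es) $$ (i, j) = diagonal (ds @ es) $$ (i, j)"
    by (subst block_diag_index[OF diagonal_carrier diagonal_carrier ij])
      (auto simp: diagonal_def nth_append)
qed (simp_all add: block_diag_def diagonal_def)

lemma char_poly_diagonal: "char_poly (diagonal ds) = (\<Prod>d \<leftarrow> ds. [:- d, 1:])"
proof -
  have "upper_triangular (diagonal ds)" by (auto simp: diagonal_def)
  moreover have "diag_mat (diagonal ds) = ds"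
    by (rule nth_equalityI) (simp_all add: diag_mat_def diagonal_def)
  ultimately show ?thesis
    using char_poly_upper_triangular[OF diagonal_carrier] by simp
qed

text \<open>Recovers multiplicities from a product of linear factors, so that equal characteristic
  polynomials give equal root counts.\<close>

lemma order_prod_linear_factors:
  "order x (\<Prod>d \<leftarrow> ds. [:- d, 1:]) = count_list ds (x :: real)"
proof (induction ds)
  case (Cons d ds)
  have nz: "(\<Prod>d \<leftarrow> ds. [:- d, 1:]) \<noteq> 0" for ds :: "real list"
    by (induction ds) (auto simp del: mult_pCons_left)
  have "order x [:- d, 1:] = (if d = x then 1 else 0)"
    using order_power_n_n[of d 1] order_0I[of "[:- d, 1:]" x] by auto
  then show ?case
    using order_mult[of "[:- d, 1:]" "\<Prod>d \<leftarrow> ds. [:- d, 1:]" x] nz[of "d # ds"] Cons.IH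
    by simp
qed (simp add: order_0I)

text \<open>The square of \<open>minkowski 3 * null_block\<close>: a nonzero matrix of square zero
  whose image is spanned by the null vector (1, 0, 1).\<close>

definition null_square :: "real mat" where
  "null_square = mat 3 3 (\<lambda>(i, j). if i = 1 \<or> j = 1 then 0 else if j = 0 then 1 else - 1)"

lemma char_poly_null_square: "char_poly null_square = (\<Prod>d \<leftarrow> [0, 0, 0]. [:- d, 1:])"
proof -
  \<comment> \<open>The columns of P are (1, 0, 1) and the last two unit vectors, a basis in which
    \<open>null_square\<close> becomes the strictly upper triangular \<open>U\<close>; Q is the
    inverse of P.\<close>
  define P where "P = mat 3 3 (\<lambda>(i, j). if i = j \<or> (i = 2 \<and> j = 0) then 1 else 0 :: real)"
  define Q where "Q = mat 3 3 (\<lambda>(i, j). if i = j then 1 else if i = 2 \<and> j = 0 then - 1 else 0 :: real)"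
  define U where "U = mat 3 3 (\<lambda>(i, j). if i = 0 \<and> j = 2 then - 1 else 0 :: real)"
  have c: "P \<in> carrier_mat 3 3" "Q \<in> carrier_mat 3 3" "U \<in> carrier_mat 3 3" "null_square \<in> carrier_mat 3 3"
    by (simp_all add: P_def Q_def U_def null_square_def)
  have three: "{0..<3} = {0, 1, 2 :: nat}" by auto
  have "P * Q = 1\<^sub>m 3"
  proof (rule eq_matI)
    fix i j assume "i < dim_row (1\<^sub>m 3 :: real mat)" "j < dim_col (1\<^sub>m 3 :: real mat)"
    then have "i = 0 \<or> i = 1 \<or> i = 2" "j = 0 \<or> j = 1 \<or> j = 2" by auto
    then show "(P * Q) $$ (i, j) = 1\<^sub>m 3 $$ (i, j)"
      by (elim disjE) (simp_all add: P_def Q_def scalar_prod_def three)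
  qed (simp_all add: P_def Q_def)
  moreover have "Q * P = 1\<^sub>m 3"
    by (rule mat_mult_left_right_inverse[OF c(1,2) calculation])
  moreover have "null_square = P * U * Q"
  proof (rule eq_matI)
    fix i j assume "i < dim_row (P * U * Q)" "j < dim_col (P * U * Q)"
    then have "i = 0 \<or> i = 1 \<or> i = 2" "j = 0 \<or> j = 1 \<or> j = 2"
      by (auto simp: P_def Q_def)
    then show "null_square $$ (i, j) = (P * U * Q) $$ (i, j)"
      by (elim disjE) (simp_all add: P_def Q_def U_def null_square_def scalar_prod_def three)
  qed (simp_all add: P_def Q_def null_square_def)
  ultimately have "similar_mat null_square U"
    unfolding similar_mat_def using similar_mat_witI[of P Q 3 null_square U] c by blast
  then have "char_poly null_square = char_poly U" by (rule char_poly_similar)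
  also have "\<dots> = (\<Prod>d \<leftarrow> diag_mat U. [:- d, 1:])"
    by (rule char_poly_upper_triangular[OF c(3)]) (auto simp: U_def)
  also have "diag_mat U = [0, 0, 0]"
    by (simp add: diag_mat_def U_def numeral_3_eq_3)
  finally show ?thesis .
qed

fun core_block :: "normal_form \<Rightarrow> real mat" where
  "core_block Zero = 0\<^sub>m 1 1"
| "core_block (Rotations bs) = 0\<^sub>m 1 1"
| "core_block (Boost a) = plane_block a"
| "core_block (Boost_Rotations a bs) = plane_block a"
| "core_block Null = null_block"
| "core_block (Null_Rotations bs) = null_block"

fun core_dim :: "normal_form \<Rightarrow> nat" where
  "core_dim Zero = 1"
| "core_dim (Rotations bs) = 1"
| "core_dim (Boost a) = 2"
| "core_dim (Boost_Rotations a bs) = 2"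
| "core_dim Null = 3"
| "core_dim (Null_Rotations bs) = 3"

fun coeffs_of :: "normal_form \<Rightarrow> real list" where
  "coeffs_of (Rotations bs) = bs"
| "coeffs_of (Boost_Rotations a bs) = bs"
| "coeffs_of (Null_Rotations bs) = bs"
| "coeffs_of _ = []"

text \<open>Eigenvalues, with multiplicity, of the square of the metric times the core block. Boosts
  give positive ones, rotation planes negative ones, so the two kinds of parameters cannot be
  confused.\<close>

fun core_spectrum :: "normal_form \<Rightarrow> real list" where
  "core_spectrum Zero = [0]"
| "core_spectrum (Rotations bs) = [0]"
| "core_spectrum (Boost a) = [a\<^sup>2, a\<^sup>2]"
| "core_spectrum (Boost_Rotations a bs) = [a\<^sup>2, a\<^sup>2]"
| "core_spectrum Null = [0, 0, 0]"
| "core_spectrum (Null_Rotations bs) = [0, 0, 0]"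

lemma core_block_carrier: "core_block t \<in> carrier_mat (core_dim t) (core_dim t)"
  by (cases t) (simp_all add: plane_block_def null_block_def)

lemma core_dim_pos: "core_dim t > 0"
  by (cases t) simp_all

text \<open>\<open>admissible\<close> puts no bound on \<open>n\<close> for a pure boost;
  \<open>n \<ge> 1\<close> is what makes room for its plane.\<close>

lemma admissible_coeffs_of:
  assumes "admissible n t" "n \<ge> 1"
  shows "sorted_wrt (\<ge>) (coeffs_of t)" "\<And>b. b \<in> set (coeffs_of t) \<Longrightarrow> b > 0"
    "core_dim t \<le> Suc n" "2 * length (coeffs_of t) \<le> Suc n - core_dim t"
  using assms by (cases t; auto simp: admissible_coeffs_def)+

text \<open>Works because \<open>core_dim\<close> is exactly the index at which the rotation planes
  of a type begin: 1, 2 or 3.\<close>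

lemma normal_two_form_block_diag:
  assumes "Suc n = core_dim t + m"
  shows "normal_two_form n t = block_diag (core_block t) (rotation_mat m (coeffs_of t))"
proof -
  have "normal_form_components t i j = (if i < core_dim t \<and> j < core_dim t then core_block t $$ (i, j) else 0)
    + rotation_part (core_dim t) (coeffs_of t) i j" for i j
    by (cases t) (auto simp: plane_block_def null_block_def dx_wedge_def)
  then show ?thesis
    using block_diag_rotation_mat[OF core_block_carrier, where m = m and c = "normal_form_components t"] assms
    by (simp add: normal_two_form_def)
qed

lemma core_block_square:
  defines "C \<equiv> \<lambda>t. minkowski (core_dim t) * core_block t"
  shows "core_dim t \<noteq> 3 \<Longrightarrow> C t * C t = diagonal (core_spectrum t)"
    and "core_dim t = 3 \<Longrightarrow> C t * C t = null_square"
proof -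
  have 1: "{0..<1} = {0 :: nat}" and 2: "{0..<2} = {0, 1 :: nat}" and 3: "{0..<3} = {0, 1, 2 :: nat}" by auto
  have b0: "diagonal [0] = 0\<^sub>m 1 1"
    by (rule eq_matI) (simp_all add: diagonal_def)
  have b2: "(minkowski 2 * plane_block a) * (minkowski 2 * plane_block a) = diagonal [a\<^sup>2, a\<^sup>2]" (is "?l = ?r") for a
  proof -
    have "minkowski 2 * plane_block a = mat 2 2 (\<lambda>(i, j). if i = j then 0 else - a)" (is "_ = ?C")
    proof (rule eq_matI)
      fix i j assume "i < dim_row ?C" "j < dim_col ?C"
      then have "i = 0 \<or> i = 1" "j = 0 \<or> j = 1" by auto
      then show "(minkowski 2 * plane_block a) $$ (i, j) = ?C $$ (i, j)"
        by (elim disjE) (simp_all add: plane_block_def scalar_prod_def dx_wedge_def 2)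
    qed (simp_all add: plane_block_def)
    moreover have "?C * ?C = ?r"
    proof (rule eq_matI)
      fix i j assume "i < dim_row ?r" "j < dim_col ?r"
      then have "i = 0 \<or> i = 1" "j = 0 \<or> j = 1" by (auto simp: diagonal_def)
      then show "(?C * ?C) $$ (i, j) = ?r $$ (i, j)"
        by (elim disjE) (simp_all add: diagonal_def scalar_prod_def 2 power2_eq_square)
    qed (simp_all add: diagonal_def)
    ultimately show ?thesis by simp
  qed
  have b3: "(minkowski 3 * null_block) * (minkowski 3 * null_block) = null_square"
  proof -
    have "minkowski 3 * null_block = mat 3 3 (\<lambda>(i, j). if i = 1 \<and> j = 2 then 1
      else if j = 1 \<and> i \<noteq> 1 \<or> i = 1 \<and> j = 0 then - 1 else 0)" (is "_ = ?C")
    proof (rule eq_matI)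
      fix i j assume "i < dim_row ?C" "j < dim_col ?C"
      then have "i = 0 \<or> i = 1 \<or> i = 2" "j = 0 \<or> j = 1 \<or> j = 2" by auto
      then show "(minkowski 3 * null_block) $$ (i, j) = ?C $$ (i, j)"
        by (elim disjE) (simp_all add: null_block_def scalar_prod_def dx_wedge_def 3)
    qed (simp_all add: null_block_def)
    moreover have "?C * ?C = null_square"
    proof (rule eq_matI)
      fix i j assume "i < dim_row null_square" "j < dim_col null_square"
      then have "i = 0 \<or> i = 1 \<or> i = 2" "j = 0 \<or> j = 1 \<or> j = 2"
        by (auto simp: null_square_def)
      then show "(?C * ?C) $$ (i, j) = null_square $$ (i, j)"
        by (elim disjE) (simp_all add: null_square_def scalar_prod_def 3)
    qed (simp_all add: null_square_def)
    ultimately show ?thesis by simp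
  qed
  show "core_dim t \<noteq> 3 \<Longrightarrow> C t * C t = diagonal (core_spectrum t)"
    using b0 b2 by (cases t) (simp_all add: C_def)
  show "core_dim t = 3 \<Longrightarrow> C t * C t = null_square"
    using b3 by (cases t) (simp_all add: C_def)
qed

text \<open>Raising an index turns the 2-form into an endomorphism, on which the Lorentz group acts
  by conjugation. For the normal forms its square has only real eigenvalues, and the signs lost by
  squaring are restored by a > 0 and b > 0.\<close>

definition raised_square :: "nat \<Rightarrow> real mat \<Rightarrow> real mat" where
  "raised_square N F = (minkowski N * F) * (minkowski N * F)"

lemma raised_square_normal_two_form:
  assumes t: "admissible n t" "n \<ge> 1"
  shows "core_dim t \<noteq> 3 \<Longrightarrow> raised_square (Suc n) (normal_two_form n t) =
      diagonal (core_spectrum t @ square_diag (Suc n - core_dim t) (coeffs_of t))"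
    and "core_dim t = 3 \<Longrightarrow> raised_square (Suc n) (normal_two_form n t) =
      block_diag null_square (diagonal (square_diag (Suc n - core_dim t) (coeffs_of t)))"
proof -
  define k where "k = core_dim t"
  define m where "m = Suc n - k"
  note adm = admissible_coeffs_of[OF t]
  have N: "Suc n = k + m" using adm(3) by (simp add: m_def k_def)
  let ?R = "rotation_mat m (coeffs_of t)"
  let ?C = "minkowski k * core_block t"
  have K: "core_block t \<in> carrier_mat k k" unfolding k_def by (rule core_block_carrier)
  have C: "?C \<in> carrier_mat k k" by (rule mult_carrier_mat[OF signature_mat_carrier K])
  have "minkowski (k + m) * normal_two_form n t = block_diag ?C ?R"
    unfolding normal_two_form_block_diag[OF N[unfolded k_def]] signature_mat_block_diag[OF core_dim_pos[of t, folded k_def]]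
    by (subst block_diag_mult[OF signature_mat_carrier one_carrier_mat K rotation_mat_carrier])
      (simp add: left_mult_one_mat[OF rotation_mat_carrier])
  then have "raised_square (Suc n) (normal_two_form n t) = block_diag (?C * ?C) (?R * ?R)"
    unfolding raised_square_def N
    using block_diag_mult[OF C rotation_mat_carrier C rotation_mat_carrier] by simp
  also have "?R * ?R = diagonal (square_diag m (coeffs_of t))"
    by (rule rotation_mat_square) (use adm(4) in \<open>simp add: m_def k_def\<close>)
  finally have eq: "raised_square (Suc n) (normal_two_form n t) =
    block_diag (?C * ?C) (diagonal (square_diag m (coeffs_of t)))" .
  show "core_dim t \<noteq> 3 \<Longrightarrow> raised_square (Suc n) (normal_two_form n t) =
      diagonal (core_spectrum t @ square_diag (Suc n - core_dim t) (coeffs_of t))"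
    using eq core_block_square(1)[of t] by (simp add: k_def m_def block_diag_diagonal)
  show "core_dim t = 3 \<Longrightarrow> raised_square (Suc n) (normal_two_form n t) =
      block_diag null_square (diagonal (square_diag (Suc n - core_dim t) (coeffs_of t)))"
    using eq core_block_square(2)[of t] by (simp add: k_def m_def)
qed

lemma char_poly_raised_square:
  assumes t: "admissible n t" "n \<ge> 1"
  shows "char_poly (raised_square (Suc n) (normal_two_form n t)) =
    (\<Prod>d \<leftarrow> core_spectrum t @ square_diag (Suc n - core_dim t) (coeffs_of t). [:- d, 1:])"
proof (cases "core_dim t = 3")
  case False
  show ?thesis unfolding raised_square_normal_two_form(1)[OF t False] by (rule char_poly_diagonal)
next
  case True
  have "core_spectrum t = [0, 0, 0]" using True by (cases t) simp_all
  moreover have "null_square \<in> carrier_mat 3 3" by (simp add: null_square_def)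
  ultimately show ?thesis
    unfolding raised_square_normal_two_form(2)[OF t True]
    by (subst char_poly_block_diag[OF _ diagonal_carrier])
      (auto simp: char_poly_null_square char_poly_diagonal)
qed

section \<open>The Lorentz group and its action in matrix form\<close>

lemma minkowski_metric_eq: "minkowski_metric n = minkowski (Suc n)"
  unfolding minkowski_metric_def signature_mat_def by (rule eq_matI) auto

text \<open>L G L^T = G exhibits G L^T G as a right inverse of L, as G is its own inverse. For
  square matrices it is also a left inverse, and that is the same equation for the
  transpose.\<close>

lemma pseudo_orthogonal_transpose:
  assumes s: "s\<^sup>2 = 1" and L: "pseudo_orthogonal s N L"
  shows "pseudo_orthogonal s N (transpose_mat L)"
proof -
  let ?G = "signature_mat s N"
  note Lc = pseudo_orthogonalD(1)[OF L]
  have Lt: "transpose_mat L \<in> carrier_mat N N" using Lc by simp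
  have G: "?G \<in> carrier_mat N N" by simp
  note assoc = assoc_mult_mat[of _ N N _ N _ N]
  note GG = signature_mat_square[OF s, of N]
  have GL: "?G * transpose_mat L \<in> carrier_mat N N" and LtG: "transpose_mat L * ?G \<in> carrier_mat N N"
    using G Lt by auto
  have GLG: "?G * (transpose_mat L * ?G) \<in> carrier_mat N N" using G LtG by auto
  have "L * (?G * (transpose_mat L * ?G)) = (L * ?G * transpose_mat L) * ?G"
    using assoc[OF Lc G LtG] assoc[OF mult_carrier_mat[OF Lc G] Lt G] by simp
  also have "\<dots> = 1\<^sub>m N" unfolding pseudo_orthogonalD(2)[OF L] by (rule GG)
  finally have "(?G * (transpose_mat L * ?G)) * L = 1\<^sub>m N"
    by (rule mat_mult_left_right_inverse[OF Lc GLG])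
  then have "?G * ((?G * (transpose_mat L * ?G)) * L) = ?G"
    using right_mult_one_mat[OF G] by simp
  moreover have "?G * ((?G * (transpose_mat L * ?G)) * L) = transpose_mat L * ?G * L"
    unfolding assoc[OF G GLG Lc, symmetric] assoc[OF G G LtG, symmetric] GG left_mult_one_mat[OF LtG] ..
  ultimately show ?thesis using Lt by (simp add: pseudo_orthogonal_def)
qed

text \<open>Testing the isometry condition on unit vectors gives \<Lambda>^T G \<Lambda> = G, a
  condition on columns; in terms of rows it concerns the transpose.\<close>

lemma lorentz_group_iff:
  "\<Lambda> \<in> lorentz_group n \<longleftrightarrow> pseudo_orthogonal (- 1) (Suc n) (transpose_mat \<Lambda>)" (is "?l \<longleftrightarrow> ?r")
proof -
  let ?N = "Suc n" and ?G = "minkowski (Suc n)"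
  have G: "?G \<in> carrier_mat ?N ?N" by simp
  have Gv: "?G *\<^sub>v x \<in> carrier_vec ?N" if "x \<in> carrier_vec ?N" for x
    by (rule mult_mat_vec_carrier[OF G that])
  show ?thesis
  proof
    assume ?l
    then have \<Lambda>: "\<Lambda> \<in> carrier_mat ?N ?N" and iso: "\<And>x y. x \<in> carrier_vec ?N \<Longrightarrow> y \<in> carrier_vec ?N \<Longrightarrow>
        (\<Lambda> *\<^sub>v x) \<bullet> (?G *\<^sub>v (\<Lambda> *\<^sub>v y)) = x \<bullet> (?G *\<^sub>v y)"
      by (simp_all add: lorentz_group_def minkowski_product_def minkowski_metric_eq)
    have \<Lambda>t: "transpose_mat \<Lambda> \<in> carrier_mat ?N ?N" using \<Lambda> by simp
    have "transpose_mat \<Lambda> * ?G * transpose_mat (transpose_mat \<Lambda>) = ?G"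
    proof (rule eq_matI)
      fix i j assume "i < dim_row ?G" "j < dim_col ?G"
      then have ij: "i < ?N" "j < ?N" by simp_all
      have col: "\<Lambda> *\<^sub>v unit_vec ?N k = col \<Lambda> k" if "k < ?N" for k
        using \<Lambda> that by (intro eq_vecI) auto
      have "(transpose_mat \<Lambda> * ?G * transpose_mat (transpose_mat \<Lambda>)) $$ (i, j) =
          row (transpose_mat \<Lambda>) i \<bullet> (?G *\<^sub>v row (transpose_mat \<Lambda>) j)"
        by (rule congruence_index[OF \<Lambda>t G ij])
      also have "\<dots> = (\<Lambda> *\<^sub>v unit_vec ?N i) \<bullet> (?G *\<^sub>v (\<Lambda> *\<^sub>v unit_vec ?N j))"
        unfolding col[OF ij(1)] col[OF ij(2)] using \<Lambda> ij by simp
      also have "\<dots> = unit_vec ?N i \<bullet> (?G *\<^sub>v unit_vec ?N j)" by (rule iso) simp_all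
      also have "\<dots> = (?G *\<^sub>v unit_vec ?N j) $ i"
        using scalar_prod_left_unit[OF Gv[OF unit_vec_carrier] ij(1)] by simp
      also have "\<dots> = ?G $$ (i, j)"
        using ij by (subst signature_mat_vec_index) auto
      finally show "(transpose_mat \<Lambda> * ?G * transpose_mat (transpose_mat \<Lambda>)) $$ (i, j) = ?G $$ (i, j)" .
    qed (use \<Lambda> in simp_all)
    with \<Lambda>t show ?r by (simp add: pseudo_orthogonal_def)
  next
    assume r: ?r
    have \<Lambda>t: "transpose_mat \<Lambda> \<in> carrier_mat ?N ?N" by (rule pseudo_orthogonalD(1)[OF r])
    then have \<Lambda>: "\<Lambda> \<in> carrier_mat ?N ?N" by simp
    have eq: "transpose_mat \<Lambda> * ?G * \<Lambda> = ?G" using pseudo_orthogonalD(2)[OF r] by simp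
    have "(\<Lambda> *\<^sub>v x) \<bullet> (?G *\<^sub>v (\<Lambda> *\<^sub>v y)) = x \<bullet> (?G *\<^sub>v y)"
      if x: "x \<in> carrier_vec ?N" and y: "y \<in> carrier_vec ?N" for x y
    proof -
      have \<Lambda>y: "\<Lambda> *\<^sub>v y \<in> carrier_vec ?N" by (rule mult_mat_vec_carrier[OF \<Lambda> y])
      have "(\<Lambda> *\<^sub>v x) \<bullet> (?G *\<^sub>v (\<Lambda> *\<^sub>v y)) = x \<bullet> (transpose_mat \<Lambda> *\<^sub>v (?G *\<^sub>v (\<Lambda> *\<^sub>v y)))"
        using transpose_vec_mult_scalar[OF \<Lambda>t Gv[OF \<Lambda>y] x] by simp
      also have "transpose_mat \<Lambda> *\<^sub>v (?G *\<^sub>v (\<Lambda> *\<^sub>v y)) = (transpose_mat \<Lambda> * ?G) *\<^sub>v (\<Lambda> *\<^sub>v y)"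
        by (rule assoc_mult_mat_vec[OF \<Lambda>t G \<Lambda>y, symmetric])
      also have "\<dots> = (transpose_mat \<Lambda> * ?G * \<Lambda>) *\<^sub>v y"
        by (rule assoc_mult_mat_vec[OF mult_carrier_mat[OF \<Lambda>t G] \<Lambda> y, symmetric])
      finally show ?thesis unfolding eq .
    qed
    with \<Lambda> show ?l
      by (simp add: lorentz_group_def minkowski_product_def minkowski_metric_eq)
  qed
qed

lemma pseudo_orthogonal_signature_mat:
  assumes "s\<^sup>2 = 1"
  shows "pseudo_orthogonal s N (signature_mat s N)"
  unfolding pseudo_orthogonal_def
  by (simp add: signature_mat_square[OF assms] left_mult_one_mat[OF signature_mat_carrier])

lemma pseudo_orthogonal_lower_raise:
  assumes "\<Lambda> \<in> lorentz_group n"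
  shows "pseudo_orthogonal (- 1) (Suc n) (lower_raise n \<Lambda>)"
proof -
  have s: "(- 1 :: real)\<^sup>2 = 1" by simp
  have "pseudo_orthogonal (- 1) (Suc n) \<Lambda>"
    using pseudo_orthogonal_transpose[OF s assms[unfolded lorentz_group_iff]] by simp
  then show ?thesis
    unfolding lower_raise_def minkowski_metric_eq
    by (intro pseudo_orthogonal_mult pseudo_orthogonal_signature_mat[OF s])
qed

text \<open>Conjugation by the metric G is an involution that preserves pseudo-orthogonality, so G L
  G is a preimage of L.\<close>

lemma ex_lower_raise:
  assumes "pseudo_orthogonal (- 1) (Suc n) L"
  shows "\<exists>\<Lambda> \<in> lorentz_group n. lower_raise n \<Lambda> = L"
proof
  let ?G = "minkowski (Suc n)"
  have s: "(- 1 :: real)\<^sup>2 = 1" by simp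
  have G: "?G \<in> carrier_mat (Suc n) (Suc n)" by simp
  note Lc = pseudo_orthogonalD(1)[OF assms]
  have "pseudo_orthogonal (- 1) (Suc n) (?G * L * ?G)"
    by (intro pseudo_orthogonal_mult pseudo_orthogonal_signature_mat[OF s] assms)
  then show "?G * L * ?G \<in> lorentz_group n"
    unfolding lorentz_group_iff by (rule pseudo_orthogonal_transpose[OF s])
  have GL: "?G * L \<in> carrier_mat (Suc n) (Suc n)" by (rule mult_carrier_mat[OF G Lc])
  have "?G * (?G * L * ?G) * ?G = ?G * (?G * L) * (?G * ?G)"
    unfolding assoc_mult_mat[OF G GL G, symmetric]
    by (rule assoc_mult_mat[OF mult_carrier_mat[OF G GL] G G])
  also have "\<dots> = (?G * ?G) * L * (?G * ?G)"
    unfolding assoc_mult_mat[OF G G Lc] ..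
  also have "\<dots> = L"
    using Lc by (simp add: signature_mat_square[OF s])
  finally show "lower_raise n (?G * L * ?G) = L"
    unfolding lower_raise_def minkowski_metric_eq .
qed

lemma lorentz_act_eq:
  assumes L: "lower_raise n \<Lambda> \<in> carrier_mat (Suc n) (Suc n)" and F: "F \<in> carrier_mat (Suc n) (Suc n)"
  shows "lorentz_act n \<Lambda> F = lower_raise n \<Lambda> * F * transpose_mat (lower_raise n \<Lambda>)"
proof (rule eq_matI)
  let ?L = "lower_raise n \<Lambda>"
  fix i j assume "i < dim_row (?L * F * transpose_mat ?L)" "j < dim_col (?L * F * transpose_mat ?L)"
  then have ij: "i < Suc n" "j < Suc n" using L by simp_all
  have "row ?L i \<bullet> (F *\<^sub>v row ?L j) = (\<Sum>\<sigma> = 0..<Suc n. ?L $$ (i, \<sigma>) * (\<Sum>\<rho> = 0..<Suc n. F $$ (\<sigma>, \<rho>) * ?L $$ (j, \<rho>)))"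
    using L F ij by (simp add: scalar_prod_def)
  also have "\<dots> = (\<Sum>\<sigma>\<le>n. \<Sum>\<rho>\<le>n. ?L $$ (i, \<sigma>) * ?L $$ (j, \<rho>) * F $$ (\<sigma>, \<rho>))"
    by (simp only: sum_distrib_left atLeast0LessThan lessThan_Suc_atMost mult_ac)
  finally show "lorentz_act n \<Lambda> F $$ (i, j) = (?L * F * transpose_mat ?L) $$ (i, j)"
    unfolding congruence_index[OF L F ij] using ij by (simp add: lorentz_act_def)
qed (use L in \<open>simp_all add: lorentz_act_def\<close>)

section \<open>Orbit invariants of the raised square\<close>

lemma raised_square_similar:
  assumes L: "pseudo_orthogonal (- 1) N L" and F: "F \<in> carrier_mat N N"
  shows "similar_mat (raised_square N (L * F * transpose_mat L)) (raised_square N F)"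
proof -
  let ?G = "minkowski N"
  have s: "(- 1 :: real)\<^sup>2 = 1" by simp
  note GG = signature_mat_square[OF s, of N]
  note Lc = pseudo_orthogonalD(1)[OF L]
  have G: "?G \<in> carrier_mat N N" by simp
  have Lt: "transpose_mat L \<in> carrier_mat N N" using Lc by simp
  define A where "A = ?G * F"
  \<comment> \<open>G (L F L^T) = (G L G)(G F) L^T, and R = G L G is the inverse of L^T; so
    congruence of F is conjugation of G F.\<close>
  define R where "R = ?G * L * ?G"
  define T where "T = transpose_mat L"
  have c: "A \<in> carrier_mat N N" "R \<in> carrier_mat N N" "T \<in> carrier_mat N N"
    unfolding A_def R_def T_def by (intro mult_carrier_mat[OF _ F] mult_carrier_mat[OF mult_carrier_mat[OF G Lc] G] G Lt)+
  note assoc = assoc_mult_mat[of _ N N _ N _ N]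
  have LF: "L * F \<in> carrier_mat N N" by (rule mult_carrier_mat[OF Lc F])
  have GL: "?G * L \<in> carrier_mat N N" by (rule mult_carrier_mat[OF G Lc])
  have "R * T = ?G * (L * ?G * transpose_mat L)"
    unfolding R_def T_def assoc[OF G Lc G] by (rule assoc[OF G mult_carrier_mat[OF Lc G] Lt])
  then have RT: "R * T = 1\<^sub>m N" unfolding pseudo_orthogonalD(2)[OF L] GG .
  then have TR: "T * R = 1\<^sub>m N" by (rule mat_mult_left_right_inverse[OF c(2,3)])
  have "R * A = ?G * L * (?G * A)" unfolding R_def by (rule assoc[OF GL G c(1)])
  also have "?G * A = F"
    unfolding A_def assoc[OF G G F, symmetric] GG by (rule left_mult_one_mat[OF F])
  finally have RA: "R * A = ?G * (L * F)" unfolding assoc[OF G Lc F] .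
  have A': "?G * (L * F * transpose_mat L) = R * A * T"
    unfolding RA T_def by (rule assoc[OF G LF Lt, symmetric])
  have RAc: "R * A \<in> carrier_mat N N" and AT: "A * T \<in> carrier_mat N N" and AA: "A * A \<in> carrier_mat N N"
    using c by auto
  have "T * (R * A * T) = A * T"
    unfolding assoc[OF c(2,1,3)] assoc[OF c(3,2) AT, symmetric] TR by (rule left_mult_one_mat[OF AT])
  then have "(R * A * T) * (R * A * T) = (R * A) * (A * T)"
    using assoc[OF RAc c(3) mult_carrier_mat[OF RAc c(3)]] by simp
  also have "\<dots> = R * (A * A) * T"
    unfolding assoc[OF RAc c(1,3), symmetric] assoc[OF c(2,1,1)] ..
  finally have eq: "raised_square N (L * F * transpose_mat L) = R * raised_square N F * T"
    unfolding raised_square_def A' A_def[symmetric] .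
  have "raised_square N F \<in> carrier_mat N N" unfolding raised_square_def A_def[symmetric] by (rule AA)
  then have "similar_mat_wit (raised_square N (L * F * transpose_mat L)) (raised_square N F) R T"
    unfolding eq by (intro similar_mat_witI[OF RT TR refl _ _ c(2,3)]) (use c in auto)
  then show ?thesis unfolding similar_mat_def by blast
qed

text \<open>Whether the eigenvalue 0 is semisimple tells the null forms from the rotations, which
  the characteristic polynomial cannot do.\<close>

definition has_nilpotent_vec :: "real mat \<Rightarrow> bool" where
  "has_nilpotent_vec S \<longleftrightarrow> (\<exists>x \<in> carrier_vec (dim_row S).
     S *\<^sub>v (S *\<^sub>v x) = 0\<^sub>v (dim_row S) \<and> S *\<^sub>v x \<noteq> 0\<^sub>v (dim_row S))"

lemma has_nilpotent_vec_similar: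
  assumes "similar_mat S' S" "has_nilpotent_vec S"
  shows "has_nilpotent_vec S'"
proof -
  obtain P Q where wit: "similar_mat_wit S' S P Q" using assms(1) by (auto simp: similar_mat_def)
  define N where "N = dim_row S'"
  note w = similar_mat_witD[OF N_def wit]
  have dim: "dim_row S = N" using w(5) by simp
  obtain x where x: "x \<in> carrier_vec N" "S *\<^sub>v (S *\<^sub>v x) = 0\<^sub>v N" "S *\<^sub>v x \<noteq> 0\<^sub>v N"
    using assms(2) unfolding has_nilpotent_vec_def dim by blast
  have Sx: "S *\<^sub>v x \<in> carrier_vec N" by (rule mult_mat_vec_carrier[OF w(5) x(1)])
  have QP: "Q *\<^sub>v (P *\<^sub>v y) = y" if "y \<in> carrier_vec N" for y
    using assoc_mult_mat_vec[OF w(7,6) that] w(2) that by simp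
  have S': "S' *\<^sub>v (P *\<^sub>v y) = P *\<^sub>v (S *\<^sub>v y)" if y: "y \<in> carrier_vec N" for y
  proof -
    have Py: "P *\<^sub>v y \<in> carrier_vec N" by (rule mult_mat_vec_carrier[OF w(6) y])
    have "S' *\<^sub>v (P *\<^sub>v y) = (P * S) *\<^sub>v (Q *\<^sub>v (P *\<^sub>v y))"
      unfolding w(3) by (rule assoc_mult_mat_vec[OF mult_carrier_mat[OF w(6,5)] w(7) Py])
    also have "\<dots> = P *\<^sub>v (S *\<^sub>v y)"
      unfolding QP[OF y] by (rule assoc_mult_mat_vec[OF w(6,5) y])
    finally show ?thesis .
  qed
  have P0: "P *\<^sub>v 0\<^sub>v N = 0\<^sub>v N" using w(6) by (intro eq_vecI) auto
  have Q0: "Q *\<^sub>v 0\<^sub>v N = 0\<^sub>v N" using w(7) by (intro eq_vecI) auto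
  have "S' *\<^sub>v (S' *\<^sub>v (P *\<^sub>v x)) = 0\<^sub>v N"
    unfolding S'[OF x(1)] S'[OF Sx] x(2) by (rule P0)
  moreover have "S' *\<^sub>v (P *\<^sub>v x) \<noteq> 0\<^sub>v N"
    unfolding S'[OF x(1)] using QP[OF Sx] Q0 x(3) by metis
  ultimately show ?thesis
    unfolding has_nilpotent_vec_def N_def[symmetric] using mult_mat_vec_carrier[OF w(6) x(1)] by blast
qed

lemma not_has_nilpotent_vec_diagonal: "\<not> has_nilpotent_vec (diagonal ds)"
proof
  let ?n = "length ds"
  assume "has_nilpotent_vec (diagonal ds)"
  then obtain x where x: "x \<in> carrier_vec ?n"
    and 0: "diagonal ds *\<^sub>v (diagonal ds *\<^sub>v x) = 0\<^sub>v ?n" and n0: "diagonal ds *\<^sub>v x \<noteq> 0\<^sub>v ?n"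
    by (auto simp: has_nilpotent_vec_def diagonal_def)
  have "diagonal ds *\<^sub>v (diagonal ds *\<^sub>v x) = vec ?n (\<lambda>i. ds ! i * (ds ! i * x $ i))"
    unfolding diagonal_mult_vec[OF x] by (subst diagonal_mult_vec) auto
  then have "ds ! i * (ds ! i * x $ i) = 0" if "i < ?n" for i
    using arg_cong[OF 0, of "\<lambda>v. v $ i"] that by simp
  then have "diagonal ds *\<^sub>v x = 0\<^sub>v ?n"
    unfolding diagonal_mult_vec[OF x] by (intro eq_vecI) auto
  with n0 show False ..
qed

text \<open>The time axis is a witness: its unit vector goes to the null vector e_0 + e_2, which is
  mapped to 0.\<close>

lemma has_nilpotent_vec_null_square:
  assumes D: "D \<in> carrier_mat m m"
  shows "has_nilpotent_vec (block_diag null_square D)"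
proof -
  let ?S = "block_diag null_square D" and ?N = "3 + m"
  have c: "null_square \<in> carrier_mat 3 3" by (simp add: null_square_def)
  have S: "?S \<in> carrier_mat ?N ?N" by (rule block_diag_carrier[OF c D])
  let ?e = "\<lambda>i. unit_vec ?N i :: real vec"
  have col: "?S *\<^sub>v ?e i = col ?S i" if "i < ?N" for i
    using S that by (intro eq_vecI) auto
  have Si: "?S $$ (i, j) = (if j = 0 then ?e 0 $ i + ?e 2 $ i else - (?e 0 $ i + ?e 2 $ i))"
    if "i < ?N" "j = 0 \<or> j = 2" for i j
    using that by (subst block_diag_index[OF c D]) (auto simp: null_square_def)
  have S0: "?S *\<^sub>v ?e 0 = ?e 0 + ?e 2"
    by (subst col, simp, rule eq_vecI) (use S Si in simp_all)
  have S2: "?S *\<^sub>v ?e 2 = - (?e 0 + ?e 2)"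
    by (subst col, simp, rule eq_vecI) (use S Si in simp_all)
  have "?S *\<^sub>v (?e 0 + ?e 2) = 0\<^sub>v ?N"
    unfolding mult_add_distrib_mat_vec[OF S unit_vec_carrier unit_vec_carrier] S0 S2
    by (intro eq_vecI) auto
  moreover have "?e 0 + ?e 2 \<noteq> 0\<^sub>v ?N"
  proof
    assume "?e 0 + ?e 2 = 0\<^sub>v ?N"
    then have "(?e 0 + ?e 2) $ 0 = 0\<^sub>v ?N $ 0" by simp
    then show False by (simp del: index_unit_vec add: unit_vec_def)
  qed
  ultimately show ?thesis
    unfolding has_nilpotent_vec_def using S S0 by (intro bexI[of _ "?e 0"]) auto
qed

section \<open>Recovering the normal form from its invariants\<close>

lemma count_square_diag:
  assumes "x \<noteq> 0" "\<forall>b \<in> set bs. b > 0"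
  shows "count_list (square_diag N bs) x = 2 * (if x < 0 then count_list bs (sqrt (- x)) else 0)"
  using assms(2)
proof (induction N bs rule: square_diag.induct)
  case (1 N)
  then show ?case using assms(1) by (auto simp: count_list_0_iff)
next
  case (2 N b bs)
  have "- b\<^sup>2 = x \<longleftrightarrow> x < 0 \<and> b = sqrt (- x)"
  proof
    assume a: "- b\<^sup>2 = x"
    then have "- x = b\<^sup>2" by simp
    then show "x < 0 \<and> b = sqrt (- x)" using 2(2) a by auto
  qed (use 2(2) in auto)
  then show ?case using 2 by auto
qed

lemma sorted_wrt_ge_mset_unique:
  fixes xs ys :: "real list"
  assumes "sorted_wrt (\<ge>) xs" "sorted_wrt (\<ge>) ys" "\<And>x. count_list xs x = count_list ys x"
  shows "xs = ys"
proof -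
  have "sorted (rev xs)" "sorted (rev ys)"
    using assms(1,2) by (simp_all add: sorted_wrt_rev)
  moreover have "mset (rev xs) = mset (rev ys)"
    using assms(3) by (intro multiset_eqI) (simp add: count_mset)
  ultimately have "rev xs = rev ys" by (metis properties_for_sort)
  then show ?thesis by simp
qed

text \<open>Negative roots give the rotation coefficients, positive roots the boost parameter, and a
  nilpotent vector reveals the null block. The root 0 is never compared, since the core and the
  coordinates outside the planes both contribute to it.\<close>

lemma normal_two_form_unique:
  assumes n: "n \<ge> 1" and s: "admissible n s" and t: "admissible n t"
    and L: "pseudo_orthogonal (- 1) (Suc n) L"
    and eq: "L * normal_two_form n s * transpose_mat L = normal_two_form n t"
  shows "s = t"
proof -
  let ?S = "\<lambda>t. raised_square (Suc n) (normal_two_form n t)"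
  have c: "normal_two_form n s \<in> carrier_mat (Suc n) (Suc n)" by (simp add: normal_two_form_def)
  have sim: "similar_mat (?S t) (?S s)" using raised_square_similar[OF L c] unfolding eq .
  define spec where "spec = (\<lambda>t. core_spectrum t @ square_diag (Suc n - core_dim t) (coeffs_of t))"
  have "(\<Prod>d \<leftarrow> spec s. [:- d, 1:]) = (\<Prod>d \<leftarrow> spec t. [:- d, 1:])"
    using char_poly_similar[OF sim] char_poly_raised_square[OF s n] char_poly_raised_square[OF t n]
    by (simp only: spec_def)
  then have count: "count_list (spec s) x = count_list (spec t) x" for x
    unfolding order_prod_linear_factors[symmetric] by (rule arg_cong)
  note adm = admissible_coeffs_of[OF s n] admissible_coeffs_of[OF t n]
  have pos: "\<forall>b \<in> set (coeffs_of s). b > 0" "\<forall>b \<in> set (coeffs_of t). b > 0"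
    using adm(2,6) by blast+
  have core_nonneg: "count_list (core_spectrum u) x = 0" if "x < 0" for x u
  proof -
    have "a\<^sup>2 \<noteq> x" for a using that zero_le_power2[of a] by linarith
    then show ?thesis using that by (cases u) simp_all
  qed
  have "count_list (coeffs_of s) x = count_list (coeffs_of t) x" for x
  proof (cases "x > 0")
    case True
    then have "- x\<^sup>2 < 0" "sqrt (- (- x\<^sup>2)) = x" by simp_all
    then show ?thesis
      using count[of "- x\<^sup>2"] core_nonneg count_square_diag[OF _ pos(1), of "- x\<^sup>2"]
        count_square_diag[OF _ pos(2), of "- x\<^sup>2"]
      by (simp add: spec_def)
  next
    case False
    then have "x \<notin> set (coeffs_of s)" "x \<notin> set (coeffs_of t)" using pos by auto
    then show ?thesis by (simp add: count_list_0_iff)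
  qed
  then have coeffs: "coeffs_of s = coeffs_of t"
    by (rule sorted_wrt_ge_mset_unique[OF adm(1,5)])
  have core: "count_list (core_spectrum s) (a\<^sup>2) = count_list (core_spectrum t) (a\<^sup>2)" if "a > 0" for a
  proof -
    have "a\<^sup>2 > 0" using that by simp
    then show ?thesis
      using count[of "a\<^sup>2"] count_square_diag[OF _ pos(1), of "a\<^sup>2"] count_square_diag[OF _ pos(2), of "a\<^sup>2"]
      by (simp add: spec_def)
  qed
  have "has_nilpotent_vec (?S u) \<longleftrightarrow> core_dim u = 3" if "admissible n u" for u
    using raised_square_normal_two_form[OF that n] has_nilpotent_vec_null_square[OF diagonal_carrier]
      not_has_nilpotent_vec_diagonal by (cases "core_dim u = 3") simp_all
  moreover have "has_nilpotent_vec (?S s) \<longleftrightarrow> has_nilpotent_vec (?S t)"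
    using has_nilpotent_vec_similar[OF sim] has_nilpotent_vec_similar[OF similar_mat_sym[OF sim]] by blast
  ultimately have null: "core_dim s = 3 \<longleftrightarrow> core_dim t = 3" using s t by blast
  have spec2: "\<exists>a > 0. core_spectrum u = [a\<^sup>2, a\<^sup>2]" if "admissible n u" "core_dim u = 2" for u
    using that by (cases u) auto
  \<comment> \<open>A positive root in the core characterizes the boost types, and by
    \<open>core\<close> its existence is the same for \<open>s\<close> and \<open>t\<close>.\<close>
  have boost: "(\<exists>a > 0. count_list (core_spectrum u) (a\<^sup>2) \<noteq> 0) \<longleftrightarrow> core_dim u = 2" if u: "admissible n u" for u
  proof
    assume "\<exists>a > 0. count_list (core_spectrum u) (a\<^sup>2) \<noteq> 0"
    then show "core_dim u = 2" by (cases u) auto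
  next
    assume "core_dim u = 2"
    from spec2[OF u this] obtain a where "a > 0" "core_spectrum u = [a\<^sup>2, a\<^sup>2]" by blast
    then have "a > 0 \<and> count_list (core_spectrum u) (a\<^sup>2) \<noteq> 0" by simp
    then show "\<exists>a > 0. count_list (core_spectrum u) (a\<^sup>2) \<noteq> 0" by blast
  qed
  have two: "core_dim s = 2 \<longleftrightarrow> core_dim t = 2"
    unfolding boost[OF s, symmetric] boost[OF t, symmetric] by (simp add: core cong: conj_cong)
  have dims: "core_dim u = 1 \<or> core_dim u = 2 \<or> core_dim u = 3" for u by (cases u) simp_all
  have dim: "core_dim s = core_dim t" using dims[of s] dims[of t] null two by auto
  have spec0: "hd (core_spectrum u) = 0" if "core_dim u \<noteq> 2" for u
    using that by (cases u) auto
  \<comment> \<open>The head of the core spectrum is a^2 for a boost and 0 otherwise; it carries the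
    one parameter not determined by the core dimension and the coefficient list.\<close>
  have hd: "hd (core_spectrum s) = hd (core_spectrum t)"
  proof (cases "core_dim s = 2")
    case True
    with two obtain a b where ab: "a > 0" "core_spectrum s = [a\<^sup>2, a\<^sup>2]" "core_spectrum t = [b\<^sup>2, b\<^sup>2]"
      using spec2[OF s] spec2[OF t] by blast
    show ?thesis using core[OF ab(1)] unfolding ab(2,3) by (simp split: if_splits)
  next
    case False
    with two have "core_dim t \<noteq> 2" by simp
    with False show ?thesis by (simp add: spec0)
  qed
  \<comment> \<open>Within one core dimension the two types differ by whether the coefficient list
    is empty, and \<open>admissible_coeffs\<close> tells them apart; a is recovered from a^2 by
    positivity.\<close>
  show ?thesis
    using dim coeffs hd s t
    by (cases s; cases t) (simp_all add: admissible_coeffs_def power2_eq_iff_nonneg)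
qed

text \<open>Each core block belongs to two types. As \<open>admissible_coeffs\<close> excludes the
  empty list, an empty \<open>bs\<close> selects the type without rotation planes and a nonempty one
  the other.\<close>

lemma ex_normal_form:
  assumes "sorted_wrt (\<ge>) bs" "\<forall>b \<in> set bs. b > 0" "2 * length bs \<le> m" "Suc n = k + m"
    and "K = 0\<^sub>m 1 1 \<and> k = 1 \<or> (\<exists>a > 0. K = plane_block a \<and> k = 2) \<or> K = null_block \<and> k = 3"
  shows "\<exists>t. admissible n t \<and> core_dim t = k \<and> core_block t = K \<and> coeffs_of t = bs"
  using assms(5)
proof (elim disjE exE conjE)
  assume "K = 0\<^sub>m 1 1" "k = 1"
  then show ?thesis using assms(1-4)
    by (intro exI[of _ "if bs = [] then Zero else Rotations bs"]) (auto simp: admissible_coeffs_def)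
next
  fix a :: real assume "a > 0" "K = plane_block a" "k = 2"
  then show ?thesis using assms(1-4)
    by (intro exI[of _ "if bs = [] then Boost a else Boost_Rotations a bs"]) (auto simp: admissible_coeffs_def)
next
  assume "K = null_block" "k = 3"
  then show ?thesis using assms(1-4)
    by (intro exI[of _ "if bs = [] then Null else Null_Rotations bs"]) (auto simp: admissible_coeffs_def)
qed

theorem theorem1:
  fixes n :: nat
  assumes "n \<ge> 1"
  shows "(\<forall>F \<in> two_forms n. \<exists>t. admissible n t \<and>
            (\<exists>\<Lambda> \<in> lorentz_group n. lorentz_act n \<Lambda> F = normal_two_form n t)) \<and>
         (\<forall>s t. admissible n s \<and> admissible n t \<and> s \<noteq> t \<longrightarrow>
            \<not> (\<exists>\<Lambda> \<in> lorentz_group n.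
                 lorentz_act n \<Lambda> (normal_two_form n s) = normal_two_form n t))"
proof (intro conjI ballI allI impI)
  fix F assume "F \<in> two_forms n"
  then have F: "F \<in> skew_mats (Suc n)" by (simp add: two_forms_def skew_mats_def)
  obtain L k m K bs where L: "pseudo_orthogonal (- 1) (Suc n) L" and km: "Suc n = k + m"
    and eq: "L * F * transpose_mat L = block_diag K (rotation_mat m bs)"
    and bs: "2 * length bs \<le> m" "sorted_wrt (\<ge>) bs" "\<forall>b \<in> set bs. b > 0"
    and K: "K = 0\<^sub>m 1 1 \<and> k = 1 \<or> (\<exists>a > 0. K = plane_block a \<and> k = 2) \<or> K = null_block \<and> k = 3"
    using lorentzian_normal_form[OF assms F] by blast
  obtain t where t: "admissible n t" "core_dim t = k" "core_block t = K" "coeffs_of t = bs"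
    using ex_normal_form[OF bs(2,3,1) km K] by blast
  obtain \<Lambda> where \<Lambda>: "\<Lambda> \<in> lorentz_group n" "lower_raise n \<Lambda> = L"
    using ex_lower_raise[OF L] by blast
  have "lorentz_act n \<Lambda> F = normal_two_form n t"
    using lorentz_act_eq[of n \<Lambda> F] normal_two_form_block_diag[of n t m] \<Lambda>(2) eq t km
      pseudo_orthogonalD(1)[OF L] skew_matsD(1)[OF F] by simp
  with t(1) \<Lambda>(1) show "\<exists>t. admissible n t \<and> (\<exists>\<Lambda> \<in> lorentz_group n. lorentz_act n \<Lambda> F = normal_two_form n t)"
    by blast
next
  fix s t assume st: "admissible n s \<and> admissible n t \<and> s \<noteq> t"
  show "\<not> (\<exists>\<Lambda> \<in> lorentz_group n. lorentz_act n \<Lambda> (normal_two_form n s) = normal_two_form n t)"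
  proof
    assume "\<exists>\<Lambda> \<in> lorentz_group n. lorentz_act n \<Lambda> (normal_two_form n s) = normal_two_form n t"
    then obtain \<Lambda> where \<Lambda>: "\<Lambda> \<in> lorentz_group n"
      and act: "lorentz_act n \<Lambda> (normal_two_form n s) = normal_two_form n t" by blast
    note L = pseudo_orthogonal_lower_raise[OF \<Lambda>]
    have c: "normal_two_form n s \<in> carrier_mat (Suc n) (Suc n)" by (simp add: normal_two_form_def)
    have "s = t"
      using normal_two_form_unique[OF assms _ _ L] act
      unfolding lorentz_act_eq[OF pseudo_orthogonalD(1)[OF L] c] using st by blast
    with st show False by blast
  qed
qed

end
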